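(* Let $N\ge 2$, let $(D_j,d_j)$, $1\le j\le N$, be nonempty compact metric spaces, let $\mu_j$ be a finite Borel measure on $D_j$ with $\mu_1(D_1)=\mu_j(D_j)$ for $2\le j\le N$, and let $c:D_1\times\cdots\times D_N\to\mathbb{R}$ be Lipschitz and satisfy the single-valued a.e. condition SV. If $(f_1,\dots,f_N)\in\mathcal K$ is $c$-conjugate and maximizes the functional $I$ over $\mathcal K$, then $$\inf\left\{\int_{D_1}c\big(x_1,s(x_1)\big)\,d\mu_1(x_1): s\in\mathcal S\right\}$$ is attained at $s=\partial_c f_1$. Moreover, $$\inf\left\{\int_{D_1}c\big(x_1,s(x_1)\big)\,d\mu_1(x_1): s\in\mathcal S\right\}=\sup\{I(u_1,\dots,u_N):(u_1,\dots,u_N)\in\mathcal K\}.$$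
   Context: Lipschitz means: there is $K>0$ with $|c(x_1,\dots,x_N)-c(y_1,\dots,y_N)|\le K\,(d_1(x_1,y_1)+\cdots+d_N(x_N,y_N))$ for all $x_i,y_i\in D_i$. $c$-transform: for $F=(f_1,\dots,f_N)\in C(D_1)\times\cdots\times C(D_N)$ (real-valued continuous functions), the $j$-th $c$-transform of $F$ is $$f_j^c(x_j)=\inf_{z_k\in D_k,\,k\ne j}\Big\{c(z_1,\dots,z_{j-1},x_j,z_{j+1},\dots,z_N)-\sum_{k\ne j}f_k(z_k)\Big\}.$$ The vector $(f_1,\dots,f_N)$ is $c$-conjugate if $f_j=f_j^c$ for all $1\le j\le N$. Admissible class: $\mathcal K=\{(f_1,\dots,f_N)\in C(D_1)\times\cdots\times C(D_N): f_1(x_1)+\cdots+f_N(x_N)\le c(x_1,\dots,x_N)\ \forall x_j\in D_j\}$. Functional: $I(f_1,\dots,f_N)=\sum_{j=1}^N\int_{D_j}f_j\,d\mu_j$. $c$-normal mapping: for $(f_1,\dots,f_N)$ $c$-conjugate, $\partial_cf_1$ is the multivalued map $$\partial_cf_1(x_1)=\{(z_2,\dots,z_N)\in D_2\times\cdots\times D_N: f_1(x_1)+f_2(z_2)+\cdots+f_N(z_N)=c(x_1,z_2,\dots,z_N)\}.$$ Condition SV: for each $c$-conjugate $(f_1,\dots,f_N)\in C(D_1)\times\cdots\times C(D_N)$, the set $\partial_cf_1(x_1)$ is a singleton for $\mu_1$-a.e. $x_1\in D_1$. Measure preserving: for a multivalued map $T:D_1\to D_j$, put $T^{-1}(E)=\{x_1\in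 D_1:T(x_1)\cap E\ne\emptyset\}$; $T$ is measure preserving $(\mu_1,\mu_j)$ if for every Borel set $E\subset D_j$ the set $T^{-1}(E)$ is $\mu_1$-measurable (measurable for the completion of $\mu_1$) and $\mu_1(T^{-1}(E))=\mu_j(E)$. Class $\mathcal S$: the maps $s$ from $D_1$ to $D_2\times\cdots\times D_N$, possibly multivalued but single-valued for $\mu_1$-a.e. $x_1$, such that, with $P_j$ the projection of $D_2\times\cdots\times D_N$ onto $D_j$, the map $T_j=P_j\circ s$ is measure preserving $(\mu_1,\mu_j)$ for each $2\le j\le N$. In integrals, $s(x_1)$ denotes its unique value, defined for $\mu_1$-a.e. $x_1$. *)

theory Defs
  imports "HOL-Analysis.Analysis"
begin

text \<open>
  The spaces are a family \<open>D 1, \<dots>, D N\<close> of abstract metric spaces, each with its own carrier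
  and its own metric; the carriers are subsets of one type only because HOL has no families of
  types. Points of the product are the extensional functions in
  \<open>\<Pi>\<^sub>E j\<in>{1..N}. mspace (D j)\<close>, points of \<open>D 2 \<times> \<dots> \<times> D N\<close> those in
  \<open>\<Pi>\<^sub>E j\<in>{2..N}. mspace (D j)\<close>, and \<open>z(j := x)\<close> inserts the coordinate \<open>x\<close> at place \<open>j\<close>.
  A tuple \<open>(f 1, \<dots>, f N)\<close> is given by \<open>f :: nat \<Rightarrow> 'a \<Rightarrow> real\<close>; only the values of \<open>f j\<close> on
  \<open>mspace (D j)\<close> for \<open>1 \<le> j \<le> N\<close> matter.
\<close>

definition borel_of :: "'a topology \<Rightarrow> 'a measure" where
  "borel_of X = sigma (topspace X) {U. openin X U}"

definition lipschitz_cost :: "nat \<Rightarrow> (nat \<Rightarrow> 'a metric) \<Rightarrow> ((nat \<Rightarrow> 'a) \<Rightarrow> real) \<Rightarrow> bool" where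
  "lipschitz_cost N D c \<longleftrightarrow>
     (\<exists>K>0. \<forall>x \<in> (\<Pi>\<^sub>E j\<in>{1..N}. mspace (D j)). \<forall>y \<in> (\<Pi>\<^sub>E j\<in>{1..N}. mspace (D j)).
        \<bar>c x - c y\<bar> \<le> K * (\<Sum>j=1..N. mdist (D j) (x j) (y j)))"

definition continuous_tuple :: "nat \<Rightarrow> (nat \<Rightarrow> 'a metric) \<Rightarrow> (nat \<Rightarrow> 'a \<Rightarrow> real) \<Rightarrow> bool" where
  "continuous_tuple N D f \<longleftrightarrow>
     (\<forall>j\<in>{1..N}. continuous_map (mtopology_of (D j)) euclideanreal (f j))"

text \<open>
  The real infimum below is over a nonempty set which is bounded below whenever the spaces are
  nonempty and compact, \<open>c\<close> is Lipschitz and \<open>f\<close> is a continuous tuple.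
\<close>

definition c_transform ::
  "nat \<Rightarrow> (nat \<Rightarrow> 'a metric) \<Rightarrow> ((nat \<Rightarrow> 'a) \<Rightarrow> real) \<Rightarrow> (nat \<Rightarrow> 'a \<Rightarrow> real) \<Rightarrow> nat \<Rightarrow> 'a \<Rightarrow> real" where
  "c_transform N D c f j x =
     (INF z \<in> (\<Pi>\<^sub>E k\<in>{1..N} - {j}. mspace (D k)). c (z(j := x)) - (\<Sum>k\<in>{1..N} - {j}. f k (z k)))"

definition c_conjugate ::
  "nat \<Rightarrow> (nat \<Rightarrow> 'a metric) \<Rightarrow> ((nat \<Rightarrow> 'a) \<Rightarrow> real) \<Rightarrow> (nat \<Rightarrow> 'a \<Rightarrow> real) \<Rightarrow> bool" where
  "c_conjugate N D c f \<longleftrightarrow> (\<forall>j\<in>{1..N}. \<forall>x\<in>mspace (D j). f j x = c_transform N D c f j x)"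

definition admissible ::
  "nat \<Rightarrow> (nat \<Rightarrow> 'a metric) \<Rightarrow> ((nat \<Rightarrow> 'a) \<Rightarrow> real) \<Rightarrow> (nat \<Rightarrow> 'a \<Rightarrow> real) set" where
  "admissible N D c =
     {f. continuous_tuple N D f \<and>
         (\<forall>x \<in> (\<Pi>\<^sub>E j\<in>{1..N}. mspace (D j)). (\<Sum>j=1..N. f j (x j)) \<le> c x)}"

definition dual_functional :: "nat \<Rightarrow> (nat \<Rightarrow> 'a measure) \<Rightarrow> (nat \<Rightarrow> 'a \<Rightarrow> real) \<Rightarrow> real" where
  "dual_functional N \<mu> f = (\<Sum>j=1..N. \<integral>x. f j x \<partial>\<mu> j)"

definition c_normal ::
  "nat \<Rightarrow> (nat \<Rightarrow> 'a metric) \<Rightarrow> ((nat \<Rightarrow> 'a) \<Rightarrow> real) \<Rightarrow> (nat \<Rightarrow> 'a \<Rightarrow> real) \<Rightarrow> 'a \<Rightarrow> (nat \<Rightarrow> 'a) set" where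
  "c_normal N D c f x =
     {z \<in> (\<Pi>\<^sub>E j\<in>{2..N}. mspace (D j)). f 1 x + (\<Sum>j=2..N. f j (z j)) = c (z(1 := x))}"

definition condition_SV ::
  "nat \<Rightarrow> (nat \<Rightarrow> 'a metric) \<Rightarrow> (nat \<Rightarrow> 'a measure) \<Rightarrow> ((nat \<Rightarrow> 'a) \<Rightarrow> real) \<Rightarrow> bool" where
  "condition_SV N D \<mu> c \<longleftrightarrow>
     (\<forall>f. continuous_tuple N D f \<and> c_conjugate N D c f \<longrightarrow>
          (AE x in \<mu> 1. is_singleton (c_normal N D c f x)))"

definition measure_preserving_mv :: "'a measure \<Rightarrow> 'b measure \<Rightarrow> ('a \<Rightarrow> 'b set) \<Rightarrow> bool" where
  "measure_preserving_mv M M' T \<longleftrightarrow>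
     (\<forall>E\<in>sets M'. {x \<in> space M. T x \<inter> E \<noteq> {}} \<in> sets (completion M) \<and>
                  emeasure (completion M) {x \<in> space M. T x \<inter> E \<noteq> {}} = emeasure M' E)"

definition transport_maps ::
  "nat \<Rightarrow> (nat \<Rightarrow> 'a metric) \<Rightarrow> (nat \<Rightarrow> 'a measure) \<Rightarrow> ('a \<Rightarrow> (nat \<Rightarrow> 'a) set) set" where
  "transport_maps N D \<mu> =
     {s. (\<forall>x\<in>mspace (D 1). s x \<noteq> {} \<and> s x \<subseteq> (\<Pi>\<^sub>E j\<in>{2..N}. mspace (D j))) \<and>
         (AE x in \<mu> 1. is_singleton (s x)) \<and>
         (\<forall>j\<in>{2..N}. measure_preserving_mv (\<mu> 1) (\<mu> j) (\<lambda>x. (\<lambda>z. z j) ` s x))}"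

text \<open>
  The integrand is determined only outside a null set and is in general measurable only for the
  completed measure. Where \<open>s x\<close> is not a singleton, \<open>the_elem (s x)\<close> is unspecified; for
  \<open>s\<close> in \<open>transport_maps\<close> this happens on a null set only.
\<close>

definition transport_cost ::
  "(nat \<Rightarrow> 'a measure) \<Rightarrow> ((nat \<Rightarrow> 'a) \<Rightarrow> real) \<Rightarrow> ('a \<Rightarrow> (nat \<Rightarrow> 'a) set) \<Rightarrow> real" where
  "transport_cost \<mu> c s = (\<integral>x. c ((the_elem (s x))(1 := x)) \<partial>completion (\<mu> 1))"

end

theory Submission
  imports Defs
begin

text \<open>
  Integrating the constraint \<open>u 1 x + u 2 (s\<^sub>2 x) + \<dots> + u N (s\<^sub>N x) \<le> c (x, s x)\<close> along a map \<open>s\<close> with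
  the right marginals bounds the dual value of every admissible tuple \<open>u\<close> by the cost of \<open>s\<close>
  (\<open>dual_le_transport_cost\<close>). Everything else follows from one tuple and one map for which this is
  an equality, namely a \<open>c\<close>-conjugate maximizer \<open>f\<close> and its \<open>c\<close>-normal mapping: along the latter the
  constraint is an equality by definition, so only its membership in the class of transport maps
  is at stake (\<open>c_normal_optimal\<close>).

  That the \<open>c\<close>-normal mapping preserves measures is the Euler-Lagrange equation of the dual problem.
  Raise the \<open>j\<close>-th component of \<open>f\<close> by \<open>e * h\<close> and replace the first component by its
  \<open>c\<close>-transform. The new tuple is admissible. The rate at which the first component drops lies
  between two values of \<open>h\<close>, at an unperturbed and at a perturbed minimizer
  (\<open>perturbed_c_transform\<close>), and where the minimizer is unique it converges to \<open>h\<close> at the \<open>j\<close>-th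
  coordinate of the \<open>c\<close>-normal mapping (\<open>perturbed_quotient_tendsto\<close>). By maximality the integral of
  \<open>h\<close> is at most the integral of \<open>h\<close> along the mapping (\<open>maximizer_variation\<close>); with \<open>- h\<close> in place
  of \<open>h\<close> both agree, and continuous functions determine a finite Borel measure.

  The duality formula also needs that a conjugate maximizer exists (\<open>dual_maximizer_exists\<close>). Every
  admissible tuple has a conjugate majorant, obtained by transforming its components one after the
  other (\<open>c_conjugate_majorant\<close>). Conjugate tuples have the Lipschitz constant of the cost, and since
  all masses agree they can be normalized by constants without changing the functional, so a
  maximizing sequence has a convergent subsequence by an Arzela-Ascoli argument.
\<close>

text \<open>
  The first index is special throughout; index ranges and sums refer to it by the numeral \<open>1\<close>, and
  simplification should not change that form.
\<close>

declare One_nat_def [simp del]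

section \<open>Continuous functions and Borel measures on abstract metric spaces\<close>

lemma space_eq_topspace:
  assumes "sets M = sets (borel_of X)"
  shows "space M = topspace X"
proof -
  have "{U. openin X U} \<subseteq> Pow (topspace X)"
    by (auto dest: openin_subset)
  then show ?thesis
    using sets_eq_imp_space_eq[OF assms] by (simp add: borel_of_def space_measure_of_conv)
qed

lemma sets_borel_of: "sets (borel_of X) = sigma_sets (topspace X) {U. openin X U}"
  unfolding borel_of_def by (rule sets_measure_of) (auto dest: openin_subset)

lemma sets_borel_of_closedin:
  "sets (borel_of X) = sigma_sets (topspace X) {C. closedin X C}"
proof -
  have "sigma_sets (topspace X) {U. openin X U} = sigma_sets (topspace X) {C. closedin X C}"
  proof (rule sigma_sets_eqI)
    fix U assume "U \<in> {U. openin X U}"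
    then have "topspace X - (topspace X - U) \<in> sigma_sets (topspace X) {C. closedin X C}"
      by (intro sigma_sets.Compl sigma_sets.Basic) auto
    then show "U \<in> sigma_sets (topspace X) {C. closedin X C}"
      using \<open>U \<in> _\<close> openin_subset[of X U] by (simp add: double_diff)
  next
    fix C assume "C \<in> {C. closedin X C}"
    then have "topspace X - (topspace X - C) \<in> sigma_sets (topspace X) {U. openin X U}"
      by (intro sigma_sets.Compl sigma_sets.Basic) auto
    then show "C \<in> sigma_sets (topspace X) {U. openin X U}"
      using \<open>C \<in> _\<close> closedin_subset[of X C] by (simp add: double_diff)
  qed
  then show ?thesis
    by (simp add: sets_borel_of)
qed

lemma borel_measurable_continuous_map:
  assumes M: "sets M = sets (borel_of X)" and f: "continuous_map X euclideanreal f"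
  shows "f \<in> borel_measurable M"
proof (rule borel_measurableI)
  fix S :: "real set" assume "open S"
  then have "openin X {x \<in> topspace X. f x \<in> S}"
    using f by (auto simp: continuous_map_def)
  moreover have "f -` S \<inter> space M = {x \<in> topspace X. f x \<in> S}"
    using space_eq_topspace[OF M] by auto
  ultimately show "f -` S \<inter> space M \<in> sets M"
    using M by (auto simp: sets_borel_of)
qed

lemma closedin_real_sublevel:
  assumes "continuous_map X euclideanreal f"
  shows "closedin X {x \<in> topspace X. f x \<le> (a::real)}"
proof -
  have "{x \<in> topspace X. f x \<le> a} = {x \<in> topspace X. f x \<in> {..a}}"
    by simp
  then show ?thesis
    using closedin_continuous_map_preimage[OF assms, of "{..a}"] by (metis closed_atMost closed_closedin)
qed

lemma continuous_map_attains_min: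
  assumes "compact_space X" "continuous_map X euclideanreal f" "closedin X A" "A \<noteq> {}"
  obtains a where "a \<in> A" "\<And>b. b \<in> A \<Longrightarrow> f a \<le> (f b::real)"
proof -
  have "compactin euclideanreal (f ` A)"
    using assms closedin_compact_space image_compactin by blast
  then have "compact (f ` A)"
    by simp
  then show ?thesis
    using compact_attains_inf[of "f ` A"] assms(4) that by auto
qed

lemma continuous_map_bounded:
  assumes "compact_space X" "continuous_map X euclideanreal f"
  obtains B where "B \<ge> 0" "\<And>x. x \<in> topspace X \<Longrightarrow> \<bar>f x\<bar> \<le> (B::real)"
proof -
  have "compactin euclideanreal (f ` topspace X)"
    using assms compact_space_def image_compactin by blast
  then have "bounded (f ` topspace X)"
    by (simp add: compact_imp_bounded)
  then obtain B where "B > 0" "\<And>x. x \<in> topspace X \<Longrightarrow> \<bar>f x\<bar> \<le> B"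
    by (auto simp: bounded_pos)
  then show ?thesis
    using that[of B] by simp
qed

lemma continuous_map_of_Lipschitz:
  assumes "\<And>x y. \<lbrakk>x \<in> mspace m; y \<in> mspace m\<rbrakk> \<Longrightarrow> f x - f y \<le> L * mdist m x y"
  shows "continuous_map (mtopology_of m) euclideanreal f"
proof -
  have "\<bar>f x - f y\<bar> \<le> L * mdist m x y" if "x \<in> mspace m" "y \<in> mspace m" for x y
    using assms[of x y] assms[of y x] that by (simp add: mdist_commute abs_le_iff)
  then have "Lipschitz_continuous_map m euclidean_metric f"
    by (auto simp: Lipschitz_continuous_map_def dist_real_def)
  from Lipschitz_continuous_imp_continuous_map[OF this] show ?thesis
    by simp
qed

lemma mdist_triangle_diff:
  assumes "x \<in> mspace m" "y \<in> mspace m" "z \<in> mspace m"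
  shows "\<bar>mdist m x z - mdist m y z\<bar> \<le> mdist m x y"
  using mdist_triangle[of x m y z] mdist_triangle[of y m x z] assms
  by (simp add: mdist_commute abs_le_iff)

lemma mdist_self: "x \<in> mspace m \<Longrightarrow> mdist m x x = 0"
  by simp

lemma Hausdorff_space_mtopology_of: "Hausdorff_space (mtopology_of m)"
  by (simp add: mtopology_of_def Metric_space.Hausdorff_space_mtopology)

text \<open>
  The function is the distance to \<open>E\<close>. It vanishes only on \<open>E\<close> because the complement of \<open>E\<close>
  contains a ball around each of its points.
\<close>

lemma distance_to_closedin:
  assumes E: "closedin (mtopology_of m) E" "E \<noteq> {}"
  obtains g :: "'a \<Rightarrow> real" where "continuous_map (mtopology_of m) euclideanreal g"
    "\<And>x. x \<in> mspace m \<Longrightarrow> 0 \<le> g x" "\<And>x. x \<in> mspace m \<Longrightarrow> g x = 0 \<longleftrightarrow> x \<in> E"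
proof -
  define g where "g x = (INF e\<in>E. mdist m x e)" for x
  have Em: "E \<subseteq> mspace m"
    using closedin_subset[OF E(1)] by simp
  have bdd: "bdd_below ((\<lambda>e. mdist m x e) ` E)" for x
    by (rule bdd_belowI2[of _ 0]) simp
  have g_le: "g x \<le> mdist m x e" if "e \<in> E" for x e
    unfolding g_def using bdd that by (rule cINF_lower)
  have g_nonneg: "0 \<le> g x" for x
    unfolding g_def by (rule cINF_greatest) (use E in auto)
  have g_Lipschitz: "g x - g y \<le> 1 * mdist m x y" if "x \<in> mspace m" "y \<in> mspace m" for x y
  proof -
    have "g x - mdist m x y \<le> g y"
      unfolding g_def[of y]
    proof (rule cINF_greatest)
      fix e assume "e \<in> E"
      then show "g x - mdist m x y \<le> mdist m y e"
        using g_le[of e x] mdist_triangle[of x m y e] that Em by fastforce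
    qed (use E in auto)
    then show ?thesis by simp
  qed
  have "x \<in> E" if x: "x \<in> mspace m" "g x = 0" for x
  proof (rule ccontr)
    assume "x \<notin> E"
    moreover have "openin (mtopology_of m) (mspace m - E)"
      using E(1) by (metis openin_closedin_eq openin_diff openin_topspace topspace_mtopology_of)
    ultimately obtain r where r: "r > 0" "mball_of m x r \<subseteq> mspace m - E"
      using x Metric_space.openin_mtopology[OF Metric_space_mspace_mdist]
      by (metis DiffI mball_of_def mtopology_of_def)
    have "r \<le> g x"
      unfolding g_def
    proof (rule cINF_greatest)
      fix e assume "e \<in> E"
      then show "r \<le> mdist m x e"
        using r x Em by (force simp: not_less[symmetric])
    qed (use E in auto)
    then show False
      using r x by simp
  qed
  moreover have "g x = 0" if "x \<in> E" for x
    using g_le[OF that, of x] g_nonneg[of x] mdist_self[OF subsetD[OF Em that]] by simp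
  ultimately show ?thesis
    using that[of g] continuous_map_of_Lipschitz[of m g 1] g_Lipschitz g_nonneg by blast
qed

text \<open>
  The functions \<open>max 0 (1 - n * g)\<close>, where \<open>g\<close> is the distance to a closed set, decrease to the
  indicator of that set; hence integrals of continuous functions determine the measure.
\<close>

lemma measure_eqI_continuous:
  fixes m :: "'a metric"
  assumes M: "sets M = sets (borel_of (mtopology_of m))" "finite_measure M"
    and M': "sets M' = sets (borel_of (mtopology_of m))" "finite_measure M'"
    and eq: "\<And>h. continuous_map (mtopology_of m) euclideanreal h \<Longrightarrow> (\<integral>x. h x \<partial>M) = (\<integral>x. h x \<partial>M')"
  shows "M = M'"
proof -
  let ?X = "mtopology_of m"
  have lim: "(\<lambda>n. \<integral>x. max 0 (1 - real n * g x) \<partial>L) \<longlonglongrightarrow> measure L E"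
    if L: "sets L = sets (borel_of ?X)" "finite_measure L" and E: "closedin ?X E"
      and g: "continuous_map ?X euclideanreal g"
      "\<And>x. x \<in> mspace m \<Longrightarrow> 0 \<le> g x" "\<And>x. x \<in> mspace m \<Longrightarrow> g x = 0 \<longleftrightarrow> x \<in> E"
    for L :: "'a measure" and E g
  proof -
    interpret finite_measure L by fact
    have sp: "space L = mspace m"
      using space_eq_topspace[OF L(1)] by simp
    have E_sets: "E \<in> sets L"
      using L(1) E by (auto simp: sets_borel_of_closedin)
    have g_meas[measurable]: "g \<in> borel_measurable L"
      by (rule borel_measurable_continuous_map[OF L(1) g(1)])
    have "(\<lambda>n. \<integral>x. max 0 (1 - real n * g x) \<partial>L) \<longlonglongrightarrow> (\<integral>x. indicator E x \<partial>L)"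
    proof (rule integral_dominated_convergence[where w="\<lambda>_. 1"])
      show "indicator E \<in> borel_measurable L"
        using E_sets by simp
      show "AE x in L. (\<lambda>n. max 0 (1 - real n * g x)) \<longlonglongrightarrow> indicator E x"
      proof (rule AE_I2)
        fix x assume "x \<in> space L"
        then have x: "x \<in> mspace m"
          by (simp add: sp)
        show "(\<lambda>n. max 0 (1 - real n * g x)) \<longlonglongrightarrow> indicator E x"
        proof (cases "x \<in> E")
          case True
          then have "g x = 0"
            using g(3)[OF x] by simp
          then show ?thesis
            using True by simp
        next
          case False
          then have pos: "g x > 0"
            using g(2)[OF x] g(3)[OF x] by linarith
          then obtain n0 :: nat where "1 / g x < real n0"
            using reals_Archimedean2 by blast
          then have n0: "1 < real n0 * g x"
            using pos by (simp add: field_simps)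
          have "max 0 (1 - real n * g x) = 0" if "n \<ge> n0" for n
          proof -
            have "real n0 * g x \<le> real n * g x"
              using that pos by simp
            then show ?thesis using n0 by simp
          qed
          then have "\<forall>\<^sub>F n in sequentially. max 0 (1 - real n * g x) = 0"
            using eventually_sequentially by blast
          then show ?thesis
            using False tendsto_eventually by auto
        qed
      qed
      show "AE x in L. norm (max 0 (1 - real n * g x)) \<le> 1" for n
        by (rule AE_I2) (simp add: sp g(2))
    qed auto
    then show ?thesis
      using E_sets by simp
  qed
  interpret M: finite_measure M by fact
  interpret M': finite_measure M' by fact
  show ?thesis
  proof (rule measure_eqI_generator_eq)
    show "Int_stable {C. closedin ?X C}"
      by (auto simp: Int_stable_def)
    show "{C. closedin ?X C} \<subseteq> Pow (mspace m)"
      using closedin_subset[of ?X] by auto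
    show "sets M = sigma_sets (mspace m) {C. closedin ?X C}"
      using M(1) by (simp add: sets_borel_of_closedin)
    show "sets M' = sigma_sets (mspace m) {C. closedin ?X C}"
      using M'(1) by (simp add: sets_borel_of_closedin)
    show "range (\<lambda>i::nat. mspace m) \<subseteq> {C. closedin ?X C}"
      using closedin_topspace[of ?X] by auto
    show "(\<Union>i::nat. mspace m) = mspace m"
      by simp
    show "emeasure M (mspace m) \<noteq> \<infinity>"
      by (simp add: M.emeasure_finite)
    fix E assume "E \<in> {C. closedin ?X C}"
    then have E: "closedin ?X E" by simp
    show "emeasure M E = emeasure M' E"
    proof (cases "E = {}")
      case False
      obtain g :: "'a \<Rightarrow> real" where g: "continuous_map ?X euclideanreal g"
        "\<And>x. x \<in> mspace m \<Longrightarrow> 0 \<le> g x" "\<And>x. x \<in> mspace m \<Longrightarrow> g x = 0 \<longleftrightarrow> x \<in> E"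
        using distance_to_closedin[OF E False] by blast
      have "(\<integral>x. max 0 (1 - real n * g x) \<partial>M) = (\<integral>x. max 0 (1 - real n * g x) \<partial>M')" for n
        by (rule eq) (intro continuous_intros continuous_map_real_max continuous_map_real_mult_left g(1), auto)
      then have "measure M E = measure M' E"
        using LIMSEQ_unique[OF lim[OF M E g] ] lim[OF M' E g] by simp
      then show ?thesis
        by (simp add: M.emeasure_eq_measure M'.emeasure_eq_measure)
    qed simp
  qed
qed

text \<open>Total boundedness provides finite nets of every mesh \<open>1 / (n + 1)\<close>; \<open>Q\<close> is their union.\<close>

lemma compact_metric_countable_dense:
  assumes "compact_space (mtopology_of m)"
  obtains Q where "countable Q" "Q \<subseteq> mspace m"
    "\<And>x e. \<lbrakk>x \<in> mspace m; e > 0\<rbrakk> \<Longrightarrow> \<exists>q\<in>Q. mdist m x q < e"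
proof -
  interpret Metric_space "mspace m" "mdist m" by simp
  have "mtotally_bounded (mspace m)"
    using assms by (simp add: mtopology_of_def compact_space_eq_mcomplete_mtotally_bounded)
  then have "\<forall>n. \<exists>F. finite F \<and> F \<subseteq> mspace m \<and> mspace m \<subseteq> (\<Union>x\<in>F. mball x (inverse (Suc n)))"
    unfolding mtotally_bounded_def by simp
  then obtain F where F: "\<And>n. finite (F n)" "\<And>n. F n \<subseteq> mspace m"
    "\<And>n. mspace m \<subseteq> (\<Union>x\<in>F n. mball x (inverse (Suc n)))"
    by metis
  show ?thesis
  proof
    show "countable (\<Union>n. F n)"
      using F(1) by (simp add: countable_finite)
    show "(\<Union>n. F n) \<subseteq> mspace m"
      using F(2) by blast
    fix x and e :: real assume x: "x \<in> mspace m" and "e > 0"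
    then obtain n where n: "inverse (real (Suc n)) < e"
      using reals_Archimedean by blast
    obtain q where "q \<in> F n" "mdist m q x < inverse (real (Suc n))"
      using F(3)[of n] x by auto
    then show "\<exists>q\<in>\<Union>n. F n. mdist m x q < e"
      using n by (intro bexI[of _ q]) (auto simp: mdist_commute)
  qed
qed

text \<open>
  The next two facts let almost everywhere equal sets and functions be exchanged, which is what
  the completion of the measure is for: the multivalued maps below are single-valued only
  outside a null set.
\<close>

lemma completion_set_AE_eq:
  assumes "AE x in M. P x \<longleftrightarrow> x \<in> A" "A \<in> sets (completion M)"
  shows "{x \<in> space M. P x} \<in> sets (completion M)"
    "emeasure (completion M) {x \<in> space M. P x} = emeasure (completion M) A"
proof -
  have ae: "AE x in completion M. x \<in> A \<longleftrightarrow> x \<in> {x \<in> space M. P x}"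
    using AE_completion[OF assms(1)] AE_space by eventually_elim auto
  show *: "{x \<in> space M. P x} \<in> sets (completion M)"
    using completion.in_sets_AE[OF ae assms(2)] by auto
  show "emeasure (completion M) {x \<in> space M. P x} = emeasure (completion M) A"
    by (rule emeasure_eq_AE) (use ae * assms(2) in \<open>auto simp del: emeasure_completion\<close>)
qed

lemma borel_measurable_completion_cong_AE:
  fixes f g :: "'a \<Rightarrow> real"
  assumes f: "f \<in> borel_measurable (completion M)" and ae: "AE x in M. f x = g x"
  shows "g \<in> borel_measurable (completion M)"
proof (rule measurableI)
  fix S :: "real set" assume "S \<in> sets borel"
  then have "f -` S \<inter> space M \<in> sets (completion M)"
    using measurable_sets[OF f] by auto
  moreover have "AE x in M. g x \<in> S \<longleftrightarrow> x \<in> f -` S \<inter> space M"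
    using ae AE_space by eventually_elim auto
  ultimately have "{x \<in> space M. g x \<in> S} \<in> sets (completion M)"
    by (rule completion_set_AE_eq(1)[rotated])
  moreover have "{x \<in> space M. g x \<in> S} = g -` S \<inter> space (completion M)"
    by auto
  ultimately show "g -` S \<inter> space (completion M) \<in> sets (completion M)"
    by simp
qed simp

section \<open>The c-transform\<close>

locale Lipschitz_transport =
  fixes N :: nat and D :: "nat \<Rightarrow> 'a metric" and c :: "(nat \<Rightarrow> 'a) \<Rightarrow> real" and K :: real
  assumes N_ge_2: "N \<ge> 2"
    and nonempty: "\<And>j. j \<in> {1..N} \<Longrightarrow> mspace (D j) \<noteq> {}"
    and compact: "\<And>j. j \<in> {1..N} \<Longrightarrow> compact_space (mtopology_of (D j))"
    and K_pos: "K > 0"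
    and c_Lipschitz: "\<And>x y. \<lbrakk>x \<in> (\<Pi>\<^sub>E j\<in>{1..N}. mspace (D j)); y \<in> (\<Pi>\<^sub>E j\<in>{1..N}. mspace (D j))\<rbrakk>
      \<Longrightarrow> \<bar>c x - c y\<bar> \<le> K * (\<Sum>j=1..N. mdist (D j) (x j) (y j))"
begin

text \<open>
  The other coordinates of an optimal point are kept together with the prescribed one: all infima
  are taken over closed subsets of the full product, a single compact space.
\<close>

abbreviation points :: "(nat \<Rightarrow> 'a) set" where
  "points \<equiv> \<Pi>\<^sub>E j\<in>{1..N}. mspace (D j)"

abbreviation points_top :: "(nat \<Rightarrow> 'a) topology" where
  "points_top \<equiv> product_topology (\<lambda>j. mtopology_of (D j)) {1..N}"

lemma one_le_N [simp]: "1 \<le> N"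
  using N_ge_2 by simp

lemma one_in: "1 \<in> {1..N}"
  using N_ge_2 by simp

lemma topspace_points_top [simp]: "topspace points_top = points"
  by simp

lemma compact_points_top: "compact_space points_top"
  using compact by (simp add: compact_space_product_topology)

lemma point_in_mspace: "y \<in> points \<Longrightarrow> j \<in> {1..N} \<Longrightarrow> y j \<in> mspace (D j)"
  by (auto simp: PiE_iff)

lemma point_update: "y \<in> points \<Longrightarrow> j \<in> {1..N} \<Longrightarrow> x \<in> mspace (D j) \<Longrightarrow> y(j := x) \<in> points"
  by (auto simp: PiE_iff extensional_def)

lemma continuous_map_coordinate:
  assumes "continuous_map (mtopology_of (D j)) Y g" "j \<in> {1..N}"
  shows "continuous_map points_top Y (\<lambda>y. g (y j))"
  using continuous_map_compose[OF continuous_map_product_coordinates[OF assms(2), of "\<lambda>j. mtopology_of (D j)"] assms(1)]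
  by (simp add: o_def)

lemma continuous_map_mdist_right:
  assumes "a \<in> mspace m"
  shows "continuous_map (mtopology_of m) euclideanreal (\<lambda>x. mdist m x a)"
proof (rule continuous_map_of_Lipschitz[where L=1])
  fix x y assume "x \<in> mspace m" "y \<in> mspace m"
  then show "mdist m x a - mdist m y a \<le> 1 * mdist m x y"
    using mdist_triangle_diff[of x m y a] assms by linarith
qed

text \<open>
  The product carries no metric here, but the Lipschitz bound is itself a continuous function of
  the point in the product topology and vanishes at the base point.
\<close>

lemma continuous_cost: "continuous_map points_top euclideanreal c"
  unfolding continuous_map_atin
proof (intro ballI)
  fix y assume "y \<in> topspace points_top"
  then have y: "y \<in> points" by simp
  let ?S = "\<lambda>x. K * (\<Sum>j=1..N. mdist (D j) (x j) (y j))"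
  have "continuous_map points_top euclideanreal ?S"
    using point_in_mspace[OF y]
    by (intro continuous_map_real_mult_left continuous_map_sum
          continuous_map_coordinate[where g="\<lambda>x. mdist _ x _"] continuous_map_mdist_right) auto
  moreover have S_y: "?S y = 0"
    using point_in_mspace[OF y] by (simp add: mdist_self sum.neutral del: mdist_zero One_nat_def)
  ultimately have "(?S \<longlongrightarrow> ?S y) (atin points_top y)"
    using y unfolding continuous_map_atin topspace_points_top limitin_canonical_iff by blast
  then have S0: "(?S \<longlongrightarrow> 0) (atin points_top y)"
    by (simp only: S_y)
  have "((\<lambda>x. c x - c y) \<longlongrightarrow> 0) (atin points_top y)"
  proof (rule Lim_null_comparison[OF _ S0])
    show "\<forall>\<^sub>F x in atin points_top y. norm (c x - c y) \<le> ?S x"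
      unfolding eventually_atin topspace_points_top
      using c_Lipschitz[OF _ y] openin_topspace[of points_top]
      by (intro disjI2 exI[of _ points]) (simp add: y)
  qed
  then show "limitin euclideanreal c (c y) (atin points_top y)"
    unfolding limitin_canonical_iff by (rule LIM_zero_cancel)
qed

lemma continuous_slack:
  assumes "continuous_tuple N D f" "J \<subseteq> {1..N}"
  shows "continuous_map points_top euclideanreal (\<lambda>y. c y - (\<Sum>k\<in>J. f k (y k)))"
  using assms finite_subset[OF assms(2)]
  by (intro continuous_map_diff continuous_cost continuous_map_sum continuous_map_coordinate)
     (auto simp: continuous_tuple_def)

lemma closedin_slice:
  assumes "j \<in> {1..N}" "x \<in> mspace (D j)"
  shows "closedin points_top {y \<in> points. y j = x}"
proof -
  have "closedin (mtopology_of (D j)) {x}"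
    using assms(2) Hausdorff_space_mtopology_of
    by (intro closedin_t1_singleton Hausdorff_imp_t1_space) auto
  from closedin_continuous_map_preimage[OF
      continuous_map_product_coordinates[OF assms(1), of "\<lambda>j. mtopology_of (D j)"] this]
  show ?thesis by simp
qed

lemma points_slice_nonempty:
  assumes "j \<in> {1..N}" "x \<in> mspace (D j)"
  shows "{y \<in> points. y j = x} \<noteq> {}"
proof -
  have "points \<noteq> {}"
    using nonempty by (simp add: PiE_eq_empty_iff)
  then obtain y where "y \<in> points" by blast
  then have "y(j := x) \<in> {y \<in> points. y j = x}"
    using point_update assms by simp
  then show ?thesis by blast
qed

text \<open>
  Inserting \<open>x\<close> at place \<open>j\<close> is a bijection onto the points with \<open>j\<close>-th coordinate \<open>x\<close>, so the
  infimum can be taken over a closed subset of \<open>points\<close>, where it is attained.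
\<close>

lemma c_transform_slice:
  assumes "j \<in> {1..N}" "x \<in> mspace (D j)"
  shows "c_transform N D c f j x =
    (INF y\<in>{y \<in> points. y j = x}. c y - (\<Sum>k\<in>{1..N} - {j}. f k (y k)))"
proof -
  let ?Z = "\<Pi>\<^sub>E k\<in>{1..N} - {j}. mspace (D k)"
  have sum_eq: "(\<Sum>k\<in>{1..N} - {j}. f k ((z(j := x)) k)) = (\<Sum>k\<in>{1..N} - {j}. f k (z k))" for z
    by (rule sum.cong) auto
  have "{y \<in> points. y j = x} = (\<lambda>z. z(j := x)) ` ?Z"
  proof (intro subset_antisym subsetI)
    fix y assume y: "y \<in> {y \<in> points. y j = x}"
    then have "y j = x" by blast
    then have "y = (y(j := undefined))(j := x)"
      by (metis fun_upd_triv fun_upd_upd)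
    moreover have "y(j := undefined) \<in> ?Z"
      using y by (auto simp: PiE_iff extensional_def)
    ultimately show "y \<in> (\<lambda>z. z(j := x)) ` ?Z"
      by (rule image_eqI)
  next
    fix y assume "y \<in> (\<lambda>z. z(j := x)) ` ?Z"
    then obtain z where z: "z \<in> ?Z" "y = z(j := x)" by blast
    have "insert j {1..N} = {1..N}"
      using assms(1) by auto
    then show "y \<in> {y \<in> points. y j = x}"
      using z assms PiE_fun_upd[of x "\<lambda>k. mspace (D k)" j z "{1..N} - {j}"] by simp
  qed
  then show ?thesis
    unfolding c_transform_def by (simp only: image_image sum_eq)
qed

lemma c_transform_cong:
  assumes "\<And>k. k \<in> {1..N} - {j} \<Longrightarrow> f k = g k"
  shows "c_transform N D c f j = c_transform N D c g j"
proof -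
  have "(\<Sum>k\<in>{1..N} - {j}. f k (z k)) = (\<Sum>k\<in>{1..N} - {j}. g k (z k))" for z
    using assms by (intro sum.cong) auto
  then show ?thesis
    by (intro ext) (simp only: c_transform_def)
qed

lemma c_transform_attained:
  assumes f: "continuous_tuple N D f" and j: "j \<in> {1..N}" "x \<in> mspace (D j)"
  obtains y where "y \<in> points" "y j = x"
    "c_transform N D c f j x = c y - (\<Sum>k\<in>{1..N} - {j}. f k (y k))"
    "\<And>y'. y' \<in> points \<Longrightarrow> y' j = x \<Longrightarrow>
       c y - (\<Sum>k\<in>{1..N} - {j}. f k (y k)) \<le> c y' - (\<Sum>k\<in>{1..N} - {j}. f k (y' k))"
proof -
  let ?G = "\<lambda>y. c y - (\<Sum>k\<in>{1..N} - {j}. f k (y k))"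
  obtain y where y: "y \<in> {y \<in> points. y j = x}" "\<And>y'. y' \<in> {y \<in> points. y j = x} \<Longrightarrow> ?G y \<le> ?G y'"
    using continuous_map_attains_min[OF compact_points_top continuous_slack[OF f, of "{1..N} - {j}"]
        closedin_slice[OF j] points_slice_nonempty[OF j]] by blast
  have "c_transform N D c f j x = ?G y"
    unfolding c_transform_slice[OF j] by (rule cInf_eq_minimum) (use y in auto)
  then show ?thesis
    using y that by blast
qed

lemma c_transform_le:
  assumes "continuous_tuple N D f" "j \<in> {1..N}" "y \<in> points"
  shows "c_transform N D c f j (y j) \<le> c y - (\<Sum>k\<in>{1..N} - {j}. f k (y k))"
proof (rule c_transform_attained[OF assms(1,2) point_in_mspace[OF assms(3,2)]])
  fix y'
  assume "c_transform N D c f j (y j) = c y' - (\<Sum>k\<in>{1..N} - {j}. f k (y' k))"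
    and "\<And>y''. \<lbrakk>y'' \<in> points; y'' j = y j\<rbrakk> \<Longrightarrow>
       c y' - (\<Sum>k\<in>{1..N} - {j}. f k (y' k)) \<le> c y'' - (\<Sum>k\<in>{1..N} - {j}. f k (y'' k))"
  from this(1) this(2)[OF assms(3) refl] show ?thesis
    by (rule ord_eq_le_trans)
qed

text \<open>
  A minimizer for \<open>x'\<close>, with its \<open>j\<close>-th coordinate moved to \<open>x\<close>, competes in the infimum at \<open>x\<close>.
  The constant does not depend on \<open>f\<close>; this equicontinuity is what makes the dual problem compact.
\<close>

lemma c_transform_Lipschitz:
  assumes f: "continuous_tuple N D f" and j: "j \<in> {1..N}" and x: "x \<in> mspace (D j)" "x' \<in> mspace (D j)"
  shows "c_transform N D c f j x - c_transform N D c f j x' \<le> K * mdist (D j) x x'"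
proof -
  obtain y where y: "y \<in> points" "y j = x'"
    "c_transform N D c f j x' = c y - (\<Sum>k\<in>{1..N} - {j}. f k (y k))"
    using c_transform_attained[OF f j x(2)] by metis
  let ?y = "y(j := x)"
  have y': "?y \<in> points"
    using y j x point_update by blast
  have "(\<Sum>k=1..N. mdist (D k) (?y k) (y k)) = mdist (D j) x x' + (\<Sum>k\<in>{1..N} - {j}. mdist (D k) (?y k) (y k))"
    using j y by (subst sum.remove[of _ j]) auto
  also have "(\<Sum>k\<in>{1..N} - {j}. mdist (D k) (?y k) (y k)) = 0"
    using point_in_mspace[OF y(1)] by (intro sum.neutral) auto
  finally have "c ?y - c y \<le> K * mdist (D j) x x'"
    using c_Lipschitz[OF y' y(1)] by simp
  moreover have "c_transform N D c f j x \<le> c ?y - (\<Sum>k\<in>{1..N} - {j}. f k (?y k))"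
    using c_transform_le[OF f j y'] by simp
  moreover have "(\<Sum>k\<in>{1..N} - {j}. f k (?y k)) = (\<Sum>k\<in>{1..N} - {j}. f k (y k))"
    by (rule sum.cong) auto
  ultimately show ?thesis
    using y(3) by linarith
qed

lemma continuous_tuple_update:
  assumes "continuous_tuple N D f" "continuous_map (mtopology_of (D j)) euclideanreal g"
  shows "continuous_tuple N D (f(j := g))"
  using assms by (auto simp: continuous_tuple_def)

lemma c_transform_continuous:
  assumes "continuous_tuple N D f" "j \<in> {1..N}"
  shows "continuous_map (mtopology_of (D j)) euclideanreal (c_transform N D c f j)"
  using c_transform_Lipschitz[OF assms] by (rule continuous_map_of_Lipschitz)

lemma admissible_c_transform:
  assumes f: "continuous_tuple N D f" and j: "j \<in> {1..N}"
  shows "f(j := c_transform N D c f j) \<in> admissible N D c"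
proof -
  have "(\<Sum>k=1..N. (f(j := c_transform N D c f j)) k (y k)) \<le> c y" if "y \<in> points" for y
    using j c_transform_le[OF f j that] by (subst sum.remove[of _ j]) auto
  then show ?thesis
    using continuous_tuple_update[OF f c_transform_continuous[OF f j]] by (simp add: admissible_def)
qed

lemma admissible_le_c_transform:
  assumes f: "f \<in> admissible N D c" and j: "j \<in> {1..N}" "x \<in> mspace (D j)"
  shows "f j x \<le> c_transform N D c f j x"
proof -
  have "continuous_tuple N D f"
    using f by (simp add: admissible_def)
  then obtain y where y: "y \<in> points" "y j = x"
    "c_transform N D c f j x = c y - (\<Sum>k\<in>{1..N} - {j}. f k (y k))"
    using c_transform_attained[OF _ j] by metis
  have "(\<Sum>k=1..N. f k (y k)) \<le> c y"
    using f y by (simp add: admissible_def)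
  moreover have "(\<Sum>k=1..N. f k (y k)) = f j x + (\<Sum>k\<in>{1..N} - {j}. f k (y k))"
    using j y by (subst sum.remove[of _ j]) auto
  ultimately show ?thesis
    using y by linarith
qed

lemma c_transform_antimono:
  assumes f: "continuous_tuple N D f" and g: "continuous_tuple N D g"
    and le: "\<And>k x. \<lbrakk>k \<in> {1..N} - {j}; x \<in> mspace (D k)\<rbrakk> \<Longrightarrow> f k x \<le> g k x"
    and j: "j \<in> {1..N}" "x \<in> mspace (D j)"
  shows "c_transform N D c g j x \<le> c_transform N D c f j x"
proof -
  obtain y where y: "y \<in> points" "y j = x"
    "c_transform N D c f j x = c y - (\<Sum>k\<in>{1..N} - {j}. f k (y k))"
    using c_transform_attained[OF f j] by metis
  have "(\<Sum>k\<in>{1..N} - {j}. f k (y k)) \<le> (\<Sum>k\<in>{1..N} - {j}. g k (y k))"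
    using point_in_mspace[OF y(1)] by (intro sum_mono le) auto
  then show ?thesis
    using c_transform_le[OF g j(1) y(1)] y by simp
qed

text \<open>
  Replacing the components one after the other by their transforms makes the tuple larger. A later
  replacement does not spoil an earlier one: the transform of an earlier component can only get
  smaller, but by admissibility it stays above that component.
\<close>

lemma c_conjugate_majorant:
  assumes u: "u \<in> admissible N D c"
  obtains v where "v \<in> admissible N D c" "c_conjugate N D c v"
    "\<And>j x. \<lbrakk>j \<in> {1..N}; x \<in> mspace (D j)\<rbrakk> \<Longrightarrow> u j x \<le> v j x"
proof -
  have "m \<le> N \<Longrightarrow> \<exists>v\<in>admissible N D c.
      (\<forall>j\<in>{1..m}. \<forall>x\<in>mspace (D j). v j x = c_transform N D c v j x) \<and>
      (\<forall>j\<in>{1..N}. \<forall>x\<in>mspace (D j). u j x \<le> v j x)" for m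
  proof (induction m)
    case 0
    then show ?case
      using u by auto
  next
    case (Suc m)
    from Suc.IH[OF Suc_leD[OF Suc.prems]] obtain v where v: "v \<in> admissible N D c"
      "\<forall>j\<in>{1..m}. \<forall>x\<in>mspace (D j). v j x = c_transform N D c v j x"
      "\<forall>j\<in>{1..N}. \<forall>x\<in>mspace (D j). u j x \<le> v j x"
      by blast
    have j: "Suc m \<in> {1..N}"
      using Suc.prems by simp
    have cv: "continuous_tuple N D v"
      using v(1) by (simp add: admissible_def)
    define w where "w = v(Suc m := c_transform N D c v (Suc m))"
    have w: "w \<in> admissible N D c"
      unfolding w_def using admissible_c_transform[OF cv j] .
    then have cw: "continuous_tuple N D w"
      by (simp add: admissible_def)
    have vw: "v k x \<le> w k x" if "k \<in> {1..N}" "x \<in> mspace (D k)" for k x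
      using admissible_le_c_transform[OF v(1) that] by (auto simp: w_def)
    have "w k x = c_transform N D c w k x" if k: "k \<in> {1..Suc m}" and x: "x \<in> mspace (D k)" for k x
    proof (cases "k = Suc m")
      case True
      then show ?thesis
        using c_transform_cong[of k w v] by (simp add: w_def)
    next
      case False
      then have k: "k \<in> {1..m}" "k \<in> {1..N}"
        using k Suc.prems by auto
      have "c_transform N D c w k x \<le> c_transform N D c v k x"
        by (rule c_transform_antimono[OF cv cw _ k(2) x]) (use vw in auto)
      also have "\<dots> = w k x"
        using v(2) k(1) x False by (simp add: w_def)
      finally show ?thesis
        using admissible_le_c_transform[OF w k(2) x] by simp
    qed
    moreover have "u k x \<le> w k x" if "k \<in> {1..N}" "x \<in> mspace (D k)" for k x
      using v(3) vw[OF that] that by force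
    ultimately show ?case
      using w by blast
  qed
  from this[OF order_refl] show ?thesis
    using that unfolding c_conjugate_def by blast
qed

end

section \<open>Existence of a maximizer of the dual functional\<close>

text \<open>
  The Arzela-Ascoli argument for a family of spaces at once: the values at countably many dense
  points form a sequence in a compact countable power of the reals, which is metrizable and hence
  sequentially compact, and the common Lipschitz constant carries convergence from the dense
  points to all points. Pointwise convergence is enough for integrals by dominated convergence.
\<close>

lemma convergent_subsequence_equi_Lipschitz:
  fixes F :: "nat \<Rightarrow> nat \<Rightarrow> 'a \<Rightarrow> real" and D :: "nat \<Rightarrow> 'a metric"
  assumes compact: "\<And>j. j \<in> J \<Longrightarrow> compact_space (mtopology_of (D j))"
    and bounded: "\<And>n j x. j \<in> J \<Longrightarrow> x \<in> mspace (D j) \<Longrightarrow> \<bar>F n j x\<bar> \<le> M"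
    and Lipschitz: "\<And>n j x y. \<lbrakk>j \<in> J; x \<in> mspace (D j); y \<in> mspace (D j)\<rbrakk>
       \<Longrightarrow> F n j x - F n j y \<le> L * mdist (D j) x y"
    and L: "L > 0"
  obtains r :: "nat \<Rightarrow> nat" where "strict_mono r"
    "\<And>j x. \<lbrakk>j \<in> J; x \<in> mspace (D j)\<rbrakk> \<Longrightarrow> convergent (\<lambda>n. F (r n) j x)"
proof -
  have "\<exists>Q. countable Q \<and> Q \<subseteq> mspace (D j) \<and> (\<forall>x\<in>mspace (D j). \<forall>e>0. \<exists>q\<in>Q. mdist (D j) x q < e)"
    if "j \<in> J" for j
    by (rule compact_metric_countable_dense[OF compact[OF that]]) blast
  then obtain Q where Q: "\<And>j. j \<in> J \<Longrightarrow> countable (Q j)" "\<And>j. j \<in> J \<Longrightarrow> Q j \<subseteq> mspace (D j)"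
    "\<And>j x e. \<lbrakk>j \<in> J; x \<in> mspace (D j); e > 0\<rbrakk> \<Longrightarrow> \<exists>q\<in>Q j. mdist (D j) x q < e"
    by metis
  \<comment> \<open>The values at the points of the dense sets, as one point of a countable power of the reals.\<close>
  define G where "G n = (\<lambda>(j, i). if j \<in> J \<and> Q j \<noteq> {} then F n j (from_nat_into (Q j) i) else 0)" for n
  define C :: "(nat \<times> nat \<Rightarrow> real) set" where "C = (\<Pi>\<^sub>E p\<in>UNIV. {- \<bar>M\<bar>..\<bar>M\<bar>})"
  have "compactin (product_topology (\<lambda>p::nat \<times> nat. euclideanreal) UNIV) C"
    unfolding C_def by (subst compactin_PiE) auto
  then have "compact C"
    by (simp only: euclidean_product_topology compactin_euclidean_iff)
  then have C: "seq_compact C"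
    by (rule compact_imp_seq_compact)
  have "G n \<in> C" for n
  proof -
    have "G n (j, i) \<in> {- \<bar>M\<bar>..\<bar>M\<bar>}" for j i
    proof (cases "j \<in> J \<and> Q j \<noteq> {}")
      case True
      then have "from_nat_into (Q j) i \<in> mspace (D j)"
        using subsetD[OF Q(2) from_nat_into[of "Q j" i]] by simp
      then show ?thesis
        using bounded[of j "from_nat_into (Q j) i" n] True by (simp add: G_def abs_le_iff)
    next
      case False
      then show ?thesis
        by (auto simp: G_def)
    qed
    then show ?thesis
      by (auto simp: C_def)
  qed
  then have "\<exists>l\<in>C. \<exists>r::nat \<Rightarrow> nat. strict_mono r \<and> (G \<circ> r) \<longlonglongrightarrow> l"
    using C[unfolded seq_compact_def, THEN spec, of G] by simp
  then obtain l r where r: "strict_mono (r::nat \<Rightarrow> nat)" "(G \<circ> r) \<longlonglongrightarrow> l"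
    by blast
  have coord: "(\<lambda>n. G (r n) p) \<longlonglongrightarrow> l p" for p
    using continuous_on_tendsto_compose[OF continuous_on_product_coordinates r(2), of p] by simp
  have "convergent (\<lambda>n. F (r n) j x)" if j: "j \<in> J" and x: "x \<in> mspace (D j)" for j x
  proof -
    have "Cauchy (\<lambda>n. F (r n) j x)"
    proof (rule CauchyI)
      fix e :: real assume e: "e > 0"
      then obtain q where q: "q \<in> Q j" "mdist (D j) x q < e / (3 * L)"
        using Q(3)[OF j x, of "e / (3 * L)"] L by auto
      then obtain i where i: "from_nat_into (Q j) i = q"
        using from_nat_into_surj[OF Q(1)[OF j] q(1)] by blast
      have qm: "q \<in> mspace (D j)"
        using subsetD[OF Q(2)[OF j] q(1)] .
      have near: "\<bar>F n j x - F n j q\<bar> < e / 3" for n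
      proof -
        have "\<bar>F n j x - F n j q\<bar> \<le> L * mdist (D j) x q"
          using Lipschitz[OF j x qm, of n] Lipschitz[OF j qm x, of n]
          by (simp add: mdist_commute abs_le_iff)
        also have "\<dots> < e / 3"
          using q(2) L by (simp add: field_simps)
        finally show ?thesis .
      qed
      have ne: "Q j \<noteq> {}"
        using q(1) by blast
      have "(\<lambda>n. F (r n) j q) \<longlonglongrightarrow> l (j, i)"
        using coord[of "(j, i)"] ne j i by (simp add: G_def)
      then have "Cauchy (\<lambda>n. F (r n) j q)"
        by (rule LIMSEQ_imp_Cauchy)
      then obtain n0 where n0: "\<And>m n. m \<ge> n0 \<Longrightarrow> n \<ge> n0 \<Longrightarrow> \<bar>F (r m) j q - F (r n) j q\<bar> < e / 3"
        using CauchyD[of "\<lambda>n. F (r n) j q" "e / 3"] e by auto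
      have "\<bar>F (r m) j x - F (r n) j x\<bar> < e" if "m \<ge> n0" "n \<ge> n0" for m n
        using near[of "r m"] near[of "r n"] n0[OF that] by linarith
      then show "\<exists>n0. \<forall>m\<ge>n0. \<forall>n\<ge>n0. norm (F (r m) j x - F (r n) j x) < e"
        by auto
    qed
    then show ?thesis
      by (rule Cauchy_convergent)
  qed
  then show ?thesis
    using that r(1) by blast
qed

locale Lipschitz_transport_measures = Lipschitz_transport +
  fixes \<mu> :: "nat \<Rightarrow> 'a measure"
  assumes sets_mu: "\<And>j. j \<in> {1..N} \<Longrightarrow> sets (\<mu> j) = sets (borel_of (mtopology_of (D j)))"
    and finite_mu: "\<And>j. j \<in> {1..N} \<Longrightarrow> finite_measure (\<mu> j)"
    and mass_mu: "\<And>j. j \<in> {1..N} \<Longrightarrow> measure (\<mu> j) (mspace (D j)) = measure (\<mu> 1) (mspace (D 1))"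
begin

lemma space_mu: "j \<in> {1..N} \<Longrightarrow> space (\<mu> j) = mspace (D j)"
  using space_eq_topspace[OF sets_mu] by simp

lemma continuous_integrable:
  assumes j: "j \<in> {1..N}" and f: "continuous_map (mtopology_of (D j)) euclideanreal f"
  shows "integrable (\<mu> j) f"
proof -
  interpret finite_measure "\<mu> j" using finite_mu[OF j] .
  obtain B where "\<And>x. x \<in> mspace (D j) \<Longrightarrow> \<bar>f x\<bar> \<le> B"
    using continuous_map_bounded[OF compact[OF j] f] by auto
  then show ?thesis
    by (intro integrable_const_bound[of _ B] AE_I2 borel_measurable_continuous_map[OF sets_mu[OF j] f])
       (simp add: space_mu[OF j])
qed

lemma tuple_integrable: "continuous_tuple N D f \<Longrightarrow> j \<in> {1..N} \<Longrightarrow> integrable (\<mu> j) (f j)"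
  by (rule continuous_integrable) (auto simp: continuous_tuple_def)

lemma dual_functional_mono:
  assumes "continuous_tuple N D f" "continuous_tuple N D g"
    and "\<And>j x. \<lbrakk>j \<in> {1..N}; x \<in> mspace (D j)\<rbrakk> \<Longrightarrow> f j x \<le> g j x"
  shows "dual_functional N \<mu> f \<le> dual_functional N \<mu> g"
  unfolding dual_functional_def
  by (intro sum_mono integral_mono) (use assms tuple_integrable in \<open>auto simp: space_mu\<close>)

lemma dual_functional_shift:
  assumes f: "continuous_tuple N D f" and a: "(\<Sum>j=1..N. a j) = 0"
  shows "dual_functional N \<mu> (\<lambda>j x. f j x + a j) = dual_functional N \<mu> f"
proof -
  have "(\<integral>x. f j x + a j \<partial>\<mu> j) = (\<integral>x. f j x \<partial>\<mu> j) + a j * measure (\<mu> 1) (mspace (D 1))"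
    if j: "j \<in> {1..N}" for j
  proof -
    interpret finite_measure "\<mu> j" using finite_mu[OF j] .
    show ?thesis
      using tuple_integrable[OF f j] mass_mu[OF j] by (simp add: space_mu[OF j] mult.commute)
  qed
  then have "dual_functional N \<mu> (\<lambda>j x. f j x + a j) =
      dual_functional N \<mu> f + (\<Sum>j=1..N. a j * measure (\<mu> 1) (mspace (D 1)))"
    by (simp add: dual_functional_def sum.distrib)
  then show ?thesis
    using a by (simp flip: sum_distrib_right)
qed

text \<open>
  A conjugate tuple is Lipschitz with the constant of the cost. Since all masses agree, constants
  may be moved from one component to another; making all components but the first vanish at a
  base point bounds the tuple by a constant depending on the cost and the spaces only.
\<close>

lemma normalized_majorant:
  obtains M where "\<And>u. u \<in> admissible N D c \<Longrightarrow> \<exists>w\<in>admissible N D c.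
    dual_functional N \<mu> u \<le> dual_functional N \<mu> w \<and>
    (\<forall>j\<in>{1..N}. \<forall>x\<in>mspace (D j). \<bar>w j x\<bar> \<le> M) \<and>
    (\<forall>j\<in>{1..N}. \<forall>x\<in>mspace (D j). \<forall>y\<in>mspace (D j). w j x - w j y \<le> K * mdist (D j) x y)"
proof -
  have "points \<noteq> {}"
    using nonempty by (simp add: PiE_eq_empty_iff)
  then obtain p where p: "p \<in> points" by blast
  obtain B where B: "B \<ge> 0" "\<And>y. y \<in> points \<Longrightarrow> \<bar>c y\<bar> \<le> B"
    using continuous_map_bounded[OF compact_points_top continuous_cost] by auto
  have "\<exists>R\<ge>0. \<forall>x\<in>mspace (D j). mdist (D j) x (p j) \<le> R" if j: "j \<in> {1..N}" for j
  proof -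
    obtain R where "R \<ge> 0" "\<And>x. x \<in> topspace (mtopology_of (D j)) \<Longrightarrow> \<bar>mdist (D j) x (p j)\<bar> \<le> R"
      by (rule continuous_map_bounded[OF compact[OF j] continuous_map_mdist_right[OF point_in_mspace[OF p j]]]) blast
    then show ?thesis by auto
  qed
  then obtain R' where R': "\<And>j. j \<in> {1..N} \<Longrightarrow> R' j \<ge> 0"
    "\<And>j x. j \<in> {1..N} \<Longrightarrow> x \<in> mspace (D j) \<Longrightarrow> mdist (D j) x (p j) \<le> R' j"
    by metis
  define R where "R = (\<Sum>j=1..N. R' j)"
  have R: "mdist (D j) x (p j) \<le> R" if "j \<in> {1..N}" "x \<in> mspace (D j)" for j x
    using R'(2)[OF that] member_le_sum[of j "{1..N}" R'] that R'(1) by (fastforce simp: R_def)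
  have R0: "R \<ge> 0"
    unfolding R_def using R'(1) by (intro sum_nonneg) auto
  define M where "M = B + N * (K * R)"
  have KR: "K * R \<ge> 0" "K * R \<le> N * (K * R)"
    using R0 K_pos mult_right_mono[of 1 "real N" "K * R"] by auto
  have "\<exists>w\<in>admissible N D c.
    dual_functional N \<mu> u \<le> dual_functional N \<mu> w \<and>
    (\<forall>j\<in>{1..N}. \<forall>x\<in>mspace (D j). \<bar>w j x\<bar> \<le> M) \<and>
    (\<forall>j\<in>{1..N}. \<forall>x\<in>mspace (D j). \<forall>y\<in>mspace (D j). w j x - w j y \<le> K * mdist (D j) x y)"
    if u: "u \<in> admissible N D c" for u
  proof -
    obtain v where v: "v \<in> admissible N D c" "c_conjugate N D c v"
      "\<And>j x. \<lbrakk>j \<in> {1..N}; x \<in> mspace (D j)\<rbrakk> \<Longrightarrow> u j x \<le> v j x"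
      using c_conjugate_majorant[OF u] by blast
    have cu: "continuous_tuple N D u" and cv: "continuous_tuple N D v"
      using u v(1) by (auto simp: admissible_def)
    have v_Lip: "v j x - v j y \<le> K * mdist (D j) x y"
      if "j \<in> {1..N}" "x \<in> mspace (D j)" "y \<in> mspace (D j)" for j x y
      using c_transform_Lipschitz[OF cv that] v(2) that by (simp add: c_conjugate_def)
    \<comment> \<open>The shifts add up to zero, and all components but the first become zero at \<open>p\<close>.\<close>
    define a where "a j = (if j = 1 then \<Sum>k\<in>{1..N} - {1}. v k (p k) else - v j (p j))" for j
    define w where "w = (\<lambda>j x. v j x + a j)"
    have sum_a: "(\<Sum>j=1..N. a j) = 0"
    proof -
      have "(\<Sum>j\<in>{1..N} - {1}. a j) = (\<Sum>j\<in>{1..N} - {1}. - v j (p j))"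
        by (intro sum.cong) (auto simp: a_def)
      then have "(\<Sum>j\<in>{1..N} - {1}. a j) = - a 1"
        by (simp add: a_def sum_negf)
      then show ?thesis
        using sum.remove[of "{1..N}" 1 a] one_in by simp
    qed
    have sum_w: "(\<Sum>j=1..N. w j (y j)) = (\<Sum>j=1..N. v j (y j))" for y
      by (simp add: w_def sum.distrib sum_a)
    have cw: "continuous_tuple N D w"
      using cv unfolding continuous_tuple_def w_def by (auto intro!: continuous_map_add)
    have w: "w \<in> admissible N D c"
      using v(1) cw sum_w by (simp add: admissible_def)
    have I: "dual_functional N \<mu> u \<le> dual_functional N \<mu> w"
      using dual_functional_mono[OF cu cv v(3)] dual_functional_shift[OF cv sum_a]
      by (simp add: w_def)
    have w_p: "w j x = v j x - v j (p j)" if "j \<noteq> 1" for j x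
      using that by (simp add: w_def a_def)
    have w_small: "\<bar>w j x\<bar> \<le> K * R" if j: "j \<in> {1..N}" "j \<noteq> 1" and x: "x \<in> mspace (D j)" for j x
    proof -
      have "\<bar>w j x\<bar> \<le> K * mdist (D j) x (p j)"
        using v_Lip[OF j(1) x point_in_mspace[OF p j(1)]] v_Lip[OF j(1) point_in_mspace[OF p j(1)] x]
        by (simp add: w_p[OF j(2)] mdist_commute abs_le_iff)
      also have "\<dots> \<le> K * R"
        using R[OF j(1) x] K_pos by simp
      finally show ?thesis .
    qed
    have "\<bar>w 1 x\<bar> \<le> M" if x: "x \<in> mspace (D 1)" for x
    proof -
      have y: "p(1 := x) \<in> points"
        using point_update[OF p one_in x] .
      have "(\<Sum>j\<in>{1..N} - {1}. w j ((p(1 := x)) j)) = 0"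
        by (intro sum.neutral) (auto simp: w_p)
      then have "w 1 x = (\<Sum>j=1..N. w j ((p(1 := x)) j))"
        using sum.remove[of "{1..N}" 1 "\<lambda>j. w j ((p(1 := x)) j)"] one_in by simp
      also have "\<dots> \<le> c (p(1 := x))"
        using w y unfolding admissible_def by blast
      finally have up: "w 1 x \<le> B"
        using B(2)[OF y] by linarith
      \<comment> \<open>For the lower bound, conjugacy expresses the first component through the small ones.\<close>
      obtain y where y: "y \<in> points" "y 1 = x"
        "c_transform N D c v 1 x = c y - (\<Sum>k\<in>{1..N} - {1}. v k (y k))"
        using c_transform_attained[OF cv one_in x] by metis
      have "v 1 x = c y - (\<Sum>k\<in>{1..N} - {1}. v k (y k))"
        using v(2) y(3) x one_in by (simp add: c_conjugate_def)
      moreover have "(\<Sum>k\<in>{1..N} - {1}. w k (y k)) = (\<Sum>k\<in>{1..N} - {1}. v k (y k)) - a 1"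
        by (simp add: a_def sum_subtractf[symmetric] w_p)
      ultimately have eq: "w 1 x = c y - (\<Sum>k\<in>{1..N} - {1}. w k (y k))"
        by (simp add: w_def)
      have "(\<Sum>k\<in>{1..N} - {1}. w k (y k)) \<le> (\<Sum>k\<in>{1..N} - {1}. K * R)"
        using w_small point_in_mspace[OF y(1)] by (intro sum_mono) (auto simp: abs_le_iff)
      also have "\<dots> \<le> (\<Sum>k\<in>{1..N}. K * R)"
        using KR by (intro sum_mono2) auto
      finally have "(\<Sum>k\<in>{1..N} - {1}. w k (y k)) \<le> N * (K * R)"
        by simp
      then have "- B - N * (K * R) \<le> w 1 x"
        using eq B(2)[OF y(1)] by linarith
      then show ?thesis
        using up KR B(1) unfolding M_def by linarith
    qed
    then have "\<bar>w j x\<bar> \<le> M" if "j \<in> {1..N}" "x \<in> mspace (D j)" for j x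
      using w_small[OF that(1) _ that(2)] that KR B(1) by (cases "j = 1") (auto simp: M_def)
    then show ?thesis
      using w I v_Lip by (intro bexI[OF _ w]) (auto simp: w_def)
  qed
  then show ?thesis
    using that by blast
qed

text \<open>
  A maximizing sequence may be chosen among the normalized tuples, which are uniformly bounded and
  equi-Lipschitz, so a subsequence converges to an admissible maximizer. Conjugacy does not have to
  be followed through the limit: a conjugate majorant of the limit is again a maximizer.
\<close>

lemma dual_maximizer_exists:
  obtains f where "f \<in> admissible N D c" "c_conjugate N D c f"
    "\<And>u. u \<in> admissible N D c \<Longrightarrow> dual_functional N \<mu> u \<le> dual_functional N \<mu> f"
proof -
  obtain M where M: "\<And>u. u \<in> admissible N D c \<Longrightarrow> \<exists>w\<in>admissible N D c.
    dual_functional N \<mu> u \<le> dual_functional N \<mu> w \<and>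
    (\<forall>j\<in>{1..N}. \<forall>x\<in>mspace (D j). \<bar>w j x\<bar> \<le> M) \<and>
    (\<forall>j\<in>{1..N}. \<forall>x\<in>mspace (D j). \<forall>y\<in>mspace (D j). w j x - w j y \<le> K * mdist (D j) x y)"
    using normalized_majorant by blast
  \<comment> \<open>The normalized tuples contain, up to raising the functional, all admissible ones.\<close>
  define norm_adm where "norm_adm = {w \<in> admissible N D c.
    (\<forall>j\<in>{1..N}. \<forall>x\<in>mspace (D j). \<bar>w j x\<bar> \<le> M) \<and>
    (\<forall>j\<in>{1..N}. \<forall>x\<in>mspace (D j). \<forall>y\<in>mspace (D j). w j x - w j y \<le> K * mdist (D j) x y)}"
  have majorant: "\<exists>w\<in>norm_adm. dual_functional N \<mu> u \<le> dual_functional N \<mu> w" if "u \<in> admissible N D c" for u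
    using M[OF that] unfolding norm_adm_def by blast
  have "norm_adm \<noteq> {}"
  proof -
    have "(\<lambda>_ _. 0)(1 := c_transform N D c (\<lambda>_ _. 0) 1) \<in> admissible N D c"
      by (rule admissible_c_transform) (auto simp: continuous_tuple_def one_in)
    then show ?thesis
      using majorant by blast
  qed
  have le: "dual_functional N \<mu> w \<le> (\<Sum>j=1..N. M * measure (\<mu> j) (mspace (D j)))" if "w \<in> norm_adm" for w
    unfolding dual_functional_def
  proof (rule sum_mono)
    fix j assume j: "j \<in> {1..N}"
    interpret finite_measure "\<mu> j" using finite_mu[OF j] .
    have "(\<integral>x. w j x \<partial>\<mu> j) \<le> (\<integral>x. M \<partial>\<mu> j)"
      using that j tuple_integrable[of w j] by (intro integral_mono)
        (auto simp: norm_adm_def admissible_def space_mu[OF j] abs_le_iff)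
    then show "(\<integral>x. w j x \<partial>\<mu> j) \<le> M * measure (\<mu> j) (mspace (D j))"
      by (simp add: space_mu[OF j] mult.commute)
  qed
  define s where "s = (SUP w\<in>norm_adm. dual_functional N \<mu> w)"
  have bdd: "bdd_above (dual_functional N \<mu> ` norm_adm)"
    using le by (rule bdd_aboveI2)
  have le_s: "dual_functional N \<mu> w \<le> s" if "w \<in> norm_adm" for w
    unfolding s_def using that bdd by (rule cSUP_upper)
  have "\<exists>w\<in>norm_adm. s - inverse (Suc n) < dual_functional N \<mu> w" for n
    using less_cSUP_iff[OF \<open>norm_adm \<noteq> {}\<close> bdd, of "s - inverse (Suc n)"] by (simp flip: s_def)
  then obtain w where w: "\<And>n. w n \<in> norm_adm" "\<And>n. s - inverse (Suc n) < dual_functional N \<mu> (w n)"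
    by metis
  have w_adm: "w n \<in> admissible N D c" "continuous_tuple N D (w n)" for n
    using w(1)[of n] by (auto simp: norm_adm_def admissible_def)
  have w_bd: "\<bar>w n j x\<bar> \<le> M" if "j \<in> {1..N}" "x \<in> mspace (D j)" for n j x
    using w(1)[of n] that unfolding norm_adm_def by blast
  have w_Lip: "w n j x - w n j y \<le> K * mdist (D j) x y"
    if "j \<in> {1..N}" "x \<in> mspace (D j)" "y \<in> mspace (D j)" for n j x y
    using w(1)[of n] that unfolding norm_adm_def by blast
  obtain r where r: "strict_mono r"
    "\<And>j x. \<lbrakk>j \<in> {1..N}; x \<in> mspace (D j)\<rbrakk> \<Longrightarrow> convergent (\<lambda>n. w (r n) j x)"
    using convergent_subsequence_equi_Lipschitz[of "{1..N}" D w M K, OF compact w_bd w_Lip K_pos]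
    by blast
  define f where "f j x = lim (\<lambda>n. w (r n) j x)" for j x
  have lim: "(\<lambda>n. w (r n) j x) \<longlonglongrightarrow> f j x" if "j \<in> {1..N}" "x \<in> mspace (D j)" for j x
    using r(2)[OF that] by (simp add: f_def convergent_LIMSEQ_iff)
  have "continuous_map (mtopology_of (D j)) euclideanreal (f j)" if j: "j \<in> {1..N}" for j
  proof (rule continuous_map_of_Lipschitz)
    fix x y assume xy: "x \<in> mspace (D j)" "y \<in> mspace (D j)"
    show "f j x - f j y \<le> K * mdist (D j) x y"
      by (rule LIMSEQ_le_const2[OF tendsto_diff[OF lim[OF j xy(1)] lim[OF j xy(2)]]])
         (use w_Lip[OF j xy] in blast)
  qed
  then have cf: "continuous_tuple N D f"
    by (simp add: continuous_tuple_def)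
  have "(\<Sum>j=1..N. f j (y j)) \<le> c y" if y: "y \<in> points" for y
  proof (rule LIMSEQ_le_const2)
    show "(\<lambda>n. \<Sum>j=1..N. w (r n) j (y j)) \<longlonglongrightarrow> (\<Sum>j=1..N. f j (y j))"
      by (intro tendsto_sum lim point_in_mspace[OF y])
    show "\<exists>n0. \<forall>n\<ge>n0. (\<Sum>j=1..N. w (r n) j (y j)) \<le> c y"
      using w_adm(1) y by (auto simp: admissible_def)
  qed
  then have f: "f \<in> admissible N D c"
    using cf by (simp add: admissible_def)
  have "(\<lambda>n. dual_functional N \<mu> (w (r n))) \<longlonglongrightarrow> dual_functional N \<mu> f"
    unfolding dual_functional_def
  proof (rule tendsto_sum)
    fix j assume j: "j \<in> {1..N}"
    interpret finite_measure "\<mu> j" using finite_mu[OF j] .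
    show "(\<lambda>n. \<integral>x. w (r n) j x \<partial>\<mu> j) \<longlonglongrightarrow> (\<integral>x. f j x \<partial>\<mu> j)"
      by (rule integral_dominated_convergence[where w="\<lambda>_. M"])
         (use tuple_integrable[OF cf j] tuple_integrable[OF w_adm(2) j] w_bd[OF j] lim[OF j]
           in \<open>auto simp: space_mu[OF j]\<close>)
  qed
  moreover have "(\<lambda>n. dual_functional N \<mu> (w n)) \<longlonglongrightarrow> s"
  proof (rule tendsto_sandwich)
    show "\<forall>\<^sub>F n in sequentially. s - inverse (real (Suc n)) \<le> dual_functional N \<mu> (w n)"
      using w(2) by (simp add: less_imp_le)
    show "\<forall>\<^sub>F n in sequentially. dual_functional N \<mu> (w n) \<le> s"
      using w(1) le_s by simp
    show "(\<lambda>n. s - inverse (real (Suc n))) \<longlonglongrightarrow> s"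
      using tendsto_diff[OF tendsto_const LIMSEQ_inverse_real_of_nat, of s] by simp
  qed simp
  then have "(\<lambda>n. dual_functional N \<mu> (w (r n))) \<longlonglongrightarrow> s"
    using LIMSEQ_subseq_LIMSEQ r(1) by (fastforce simp: o_def)
  ultimately have f_s: "dual_functional N \<mu> f = s"
    by (rule LIMSEQ_unique)
  obtain g where g: "g \<in> admissible N D c" "c_conjugate N D c g"
    "\<And>j x. \<lbrakk>j \<in> {1..N}; x \<in> mspace (D j)\<rbrakk> \<Longrightarrow> f j x \<le> g j x"
    using c_conjugate_majorant[OF f] by blast
  have "dual_functional N \<mu> u \<le> dual_functional N \<mu> g" if u: "u \<in> admissible N D c" for u
  proof -
    obtain w' where "w' \<in> norm_adm" "dual_functional N \<mu> u \<le> dual_functional N \<mu> w'"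
      using majorant[OF u] by blast
    moreover have "s \<le> dual_functional N \<mu> g"
      using f_s dual_functional_mono[OF cf _ g(3)] g(1) by (simp add: admissible_def)
    ultimately show ?thesis
      using le_s by fastforce
  qed
  then show ?thesis
    using that g(1,2) by blast
qed

end

section \<open>The c-normal mapping and perturbations of a conjugate tuple\<close>

text \<open>
  For a multivalued map that is single-valued almost everywhere, \<open>T x\<close> meets \<open>E\<close> exactly when \<open>t x\<close>
  lies in \<open>E\<close>, up to a null set. This reduces the multivalued notion to push-forwards of measures.
\<close>

lemma measure_preserving_mv_iff_distr:
  assumes ae: "AE x in M. T x = {t x}" and t: "\<And>x. x \<in> space M \<Longrightarrow> t x \<in> space M'"
  shows "measure_preserving_mv M M' T \<longleftrightarrow>
    t \<in> measurable (completion M) M' \<and> distr (completion M) M' t = M'"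
proof (intro iffI conjI)
  assume mp: "measure_preserving_mv M M' T"
  have E: "{x \<in> space M. t x \<in> E} \<in> sets (completion M)"
    "emeasure (completion M) {x \<in> space M. t x \<in> E} = emeasure M' E" if "E \<in> sets M'" for E
  proof -
    let ?A = "{x \<in> space M. T x \<inter> E \<noteq> {}}"
    have A: "?A \<in> sets (completion M)" "emeasure (completion M) ?A = emeasure M' E"
      using mp that unfolding measure_preserving_mv_def by blast+
    have eq: "AE x in M. t x \<in> E \<longleftrightarrow> x \<in> ?A"
      using ae AE_space by eventually_elim auto
    show "{x \<in> space M. t x \<in> E} \<in> sets (completion M)"
      "emeasure (completion M) {x \<in> space M. t x \<in> E} = emeasure M' E"
      using completion_set_AE_eq[OF eq A(1)] A(2) by (simp_all del: emeasure_completion)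
  qed
  have vimage: "t -` E \<inter> space M = {x \<in> space M. t x \<in> E}" for E
    by auto
  show t_meas: "t \<in> measurable (completion M) M'"
    using t E(1) by (intro measurableI) (simp_all add: vimage del: emeasure_completion)
  show "distr (completion M) M' t = M'"
    by (rule measure_eqI) (simp_all add: emeasure_distr[OF t_meas] vimage E(2) del: emeasure_completion)
next
  assume asm: "t \<in> measurable (completion M) M' \<and> distr (completion M) M' t = M'"
  then have t_meas: "t \<in> measurable (completion M) M'" by blast
  show "measure_preserving_mv M M' T"
    unfolding measure_preserving_mv_def
  proof
    fix E assume E: "E \<in> sets M'"
    let ?A = "t -` E \<inter> space (completion M)"
    have A: "?A \<in> sets (completion M)"
      using t_meas E by (rule measurable_sets)
    have "emeasure (completion M) ?A = emeasure (distr (completion M) M' t) E"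
      by (rule emeasure_distr[OF t_meas E, symmetric])
    then have A': "emeasure (completion M) ?A = emeasure M' E"
      using asm by simp
    have eq: "AE x in M. T x \<inter> E \<noteq> {} \<longleftrightarrow> x \<in> ?A"
      using ae AE_space by eventually_elim auto
    show "{x \<in> space M. T x \<inter> E \<noteq> {}} \<in> sets (completion M) \<and>
        emeasure (completion M) {x \<in> space M. T x \<inter> E \<noteq> {}} = emeasure M' E"
      using completion_set_AE_eq[OF eq A] A' by (simp del: emeasure_completion)
  qed
qed

lemma distr_completion_id: "distr (completion M) M (\<lambda>x. x) = M"
proof (rule measure_eqI)
  have id: "(\<lambda>x. x) \<in> measurable (completion M) M"
    by (rule measurable_completion) simp
  fix E assume "E \<in> sets (distr (completion M) M (\<lambda>x. x))"
  then have E: "E \<in> sets M" by simp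
  have "(\<lambda>x. x) -` E \<inter> space (completion M) = E"
    using sets.sets_into_space[OF E] by auto
  then show "emeasure (distr (completion M) M (\<lambda>x. x)) E = emeasure M E"
    using emeasure_distr[OF id E] E main_part_sets[of E M] by simp
qed simp

context Lipschitz_transport
begin

lemma other_indices: "{1..N} - {1} = {2..N}"
  by auto

lemma sum_split_first: "(\<Sum>j=1..N. g j) = g 1 + (\<Sum>j=2..N. (g j :: real))"
  using sum.remove[of "{1..N}" 1 g] by (simp add: other_indices)

lemma insert_first_point:
  assumes "z \<in> (\<Pi>\<^sub>E j\<in>{2..N}. mspace (D j))" "x \<in> mspace (D 1)"
  shows "z(1 := x) \<in> points"
proof -
  have "insert 1 {2..N} = {1..N}"
    using N_ge_2 by auto
  then show ?thesis
    using PiE_fun_upd[of x "\<lambda>k. mspace (D k)" 1 z "{2..N}"] assms by simp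
qed

lemma restrict_point:
  assumes "y \<in> points"
  shows "restrict y {2..N} \<in> (\<Pi>\<^sub>E j\<in>{2..N}. mspace (D j))" "(restrict y {2..N})(1 := y 1) = y"
proof -
  show "restrict y {2..N} \<in> (\<Pi>\<^sub>E j\<in>{2..N}. mspace (D j))"
    using point_in_mspace[OF assms] by auto
  have "((restrict y {2..N})(1 := y 1)) k = y k" for k
  proof (cases "k \<in> {1..N}")
    case True
    then show ?thesis
      by (cases "k = 1") auto
  next
    case False
    then have "k \<noteq> 1" "k \<notin> {2..N}"
      by auto
    then show ?thesis
      using PiE_arb[OF assms False] by simp
  qed
  then show "(restrict y {2..N})(1 := y 1) = y"
    by (rule ext)
qed

lemma c_normal_iff:
  "z \<in> c_normal N D c f x \<longleftrightarrow> z \<in> (\<Pi>\<^sub>E j\<in>{2..N}. mspace (D j)) \<and>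
     c (z(1 := x)) - (\<Sum>j=1..N. f j ((z(1 := x)) j)) = 0"
proof -
  have "(\<Sum>j=1..N. f j ((z(1 := x)) j)) = f 1 x + (\<Sum>j=2..N. f j (z j))"
    unfolding sum_split_first by (auto intro: sum.cong)
  then show ?thesis
    unfolding c_normal_def by auto
qed

lemma restrict_in_c_normal:
  assumes "y \<in> points" "c y - (\<Sum>j=1..N. f j (y j)) = 0"
  shows "restrict y {2..N} \<in> c_normal N D c f (y 1)"
  unfolding c_normal_iff restrict_point(2)[OF assms(1)] using restrict_point(1)[OF assms(1)] assms(2) by blast

lemma c_normal_nonempty:
  assumes f: "continuous_tuple N D f" "c_conjugate N D c f" and x: "x \<in> mspace (D 1)"
  shows "c_normal N D c f x \<noteq> {}"
proof -
  obtain y where y: "y \<in> points" "y 1 = x"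
    "c_transform N D c f 1 x = c y - (\<Sum>k\<in>{1..N} - {1}. f k (y k))"
    by (rule c_transform_attained[OF f(1) one_in x]) blast
  have "f 1 x = c_transform N D c f 1 x"
    using f(2) x one_in unfolding c_conjugate_def by blast
  then have "c y - (\<Sum>j=1..N. f j (y j)) = 0"
    using y unfolding sum_split_first by (simp add: other_indices)
  then show ?thesis
    using restrict_in_c_normal[OF y(1)] y(2) by blast
qed

text \<open>
  The set of contact points of the constraint is compact, and the preimage of a closed set under
  the \<open>c\<close>-normal mapping is a projection of a closed part of it.
\<close>

lemma closedin_c_normal_preimage:
  assumes f: "f \<in> admissible N D c" and j: "j \<in> {2..N}" and E: "closedin (mtopology_of (D j)) E"
  shows "closedin (mtopology_of (D 1)) {x \<in> mspace (D 1). (\<lambda>z. z j) ` c_normal N D c f x \<inter> E \<noteq> {}}"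
proof -
  let ?slack = "\<lambda>y. c y - (\<Sum>j=1..N. f j (y j))"
  let ?S = "{y \<in> topspace points_top. ?slack y \<le> 0} \<inter> {y \<in> topspace points_top. y j \<in> E}"
  have cf: "continuous_tuple N D f"
    using f by (simp add: admissible_def)
  have j1: "j \<in> {1..N}" "j \<noteq> 1"
    using j by auto
  have "closedin points_top {y \<in> topspace points_top. y j \<in> E}"
    by (rule closedin_continuous_map_preimage[OF
          continuous_map_product_coordinates[OF j1(1), of "\<lambda>j. mtopology_of (D j)"] E])
  then have "closedin points_top ?S"
    by (intro closedin_Int closedin_real_sublevel continuous_slack[OF cf]) auto
  then have "compactin points_top ?S"
    by (rule closedin_compact_space[OF compact_points_top])
  then have "compactin (mtopology_of (D 1)) ((\<lambda>y. y 1) ` ?S)"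
    by (rule image_compactin) (rule continuous_map_product_coordinates[OF one_in, of "\<lambda>j. mtopology_of (D j)"])
  then have "closedin (mtopology_of (D 1)) ((\<lambda>y. y 1) ` ?S)"
    by (rule compactin_imp_closedin[OF Hausdorff_space_mtopology_of])
  also have "(\<lambda>y. y 1) ` ?S = {x \<in> mspace (D 1). (\<lambda>z. z j) ` c_normal N D c f x \<inter> E \<noteq> {}}"
  proof (intro subset_antisym subsetI)
    fix x assume "x \<in> (\<lambda>y. y 1) ` ?S"
    then obtain y where y: "y \<in> points" "?slack y \<le> 0" "y j \<in> E" "x = y 1"
      unfolding topspace_points_top by blast
    have "?slack y \<ge> 0"
      using f y(1) unfolding admissible_def by fastforce
    then have "restrict y {2..N} \<in> c_normal N D c f x"
      using restrict_in_c_normal[OF y(1)] y(2,4) by simp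
    moreover have "restrict y {2..N} j \<in> E"
      using y(3) j by simp
    ultimately show "x \<in> {x \<in> mspace (D 1). (\<lambda>z. z j) ` c_normal N D c f x \<inter> E \<noteq> {}}"
      using point_in_mspace[OF y(1) one_in] y(4) by blast
  next
    fix x assume "x \<in> {x \<in> mspace (D 1). (\<lambda>z. z j) ` c_normal N D c f x \<inter> E \<noteq> {}}"
    then obtain z where z: "x \<in> mspace (D 1)" "z \<in> c_normal N D c f x" "z j \<in> E"
      by blast
    then have "z(1 := x) \<in> ?S"
      using insert_first_point[of z x] j1(2) by (auto simp: c_normal_iff)
    then show "x \<in> (\<lambda>y. y 1) ` ?S"
      by (rule rev_image_eqI) simp
  qed
  finally show ?thesis .
qed

lemma sum_perturbed:
  assumes "j \<in> J" "finite J"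
  shows "(\<Sum>k\<in>J. (f(j := \<lambda>t. f j t + e * h t)) k (y k)) = (\<Sum>k\<in>J. f k (y k)) + e * (h (y j) :: real)"
proof -
  have "(\<Sum>k\<in>J. (f(j := \<lambda>t. f j t + e * h t)) k (y k)) =
      (\<Sum>k\<in>J. f k (y k) + (if k = j then e * h (y j) else 0))"
    by (rule sum.cong) auto
  then show ?thesis
    using assms by (simp add: sum.distrib)
qed

lemma continuous_tuple_perturbed:
  assumes "continuous_tuple N D f" "j \<in> {1..N}" "continuous_map (mtopology_of (D j)) euclideanreal h"
  shows "continuous_tuple N D (f(j := \<lambda>t. f j t + e * h t))"
  using assms by (intro continuous_tuple_update continuous_map_add continuous_map_real_mult_left)
    (auto simp: continuous_tuple_def)

text \<open>
  Envelope estimate: if the \<open>j\<close>-th component is perturbed by \<open>e * h\<close>, then the rate \<open>q\<close> at which the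
  first transform drops at \<open>x\<close> lies between the values of \<open>h\<close> at an unperturbed and at a
  perturbed minimizer, and the perturbed minimizer nearly satisfies the contact condition.
\<close>

lemma perturbed_c_transform:
  assumes f: "f \<in> admissible N D c" "c_conjugate N D c f" and j: "j \<in> {2..N}"
    and h: "continuous_map (mtopology_of (D j)) euclideanreal h"
    and H: "\<And>t. t \<in> mspace (D j) \<Longrightarrow> \<bar>h t\<bar> \<le> H"
    and e: "e > 0" and x: "x \<in> mspace (D 1)"
  defines "q \<equiv> (f 1 x - c_transform N D c (f(j := \<lambda>t. f j t + e * h t)) 1 x) / e"
  shows "\<And>z. z \<in> c_normal N D c f x \<Longrightarrow> h (z j) \<le> q"
    and "\<exists>y\<in>points. y 1 = x \<and> q \<le> h (y j) \<and> c y - (\<Sum>k=1..N. f k (y k)) \<le> e * (2 * H)"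
    and "\<bar>q\<bar> \<le> H"
proof -
  let ?g = "f(j := \<lambda>t. f j t + e * h t)"
  have j1: "j \<in> {1..N}" "j \<noteq> 1"
    using j by auto
  have cf: "continuous_tuple N D f"
    using f(1) by (simp add: admissible_def)
  have cg: "continuous_tuple N D ?g"
    by (rule continuous_tuple_perturbed[OF cf j1(1) h])
  have sum_g: "(\<Sum>k=2..N. ?g k (y k)) = (\<Sum>k=2..N. f k (y k)) + e * h (y j)" for y
    using j by (intro sum_perturbed) auto
  show lower: "h (z j) \<le> q" if z: "z \<in> c_normal N D c f x" for z
  proof -
    let ?y = "z(1 := x)"
    have y: "?y \<in> points"
      using insert_first_point[OF _ x] z c_normal_iff by blast
    have "c_transform N D c ?g 1 (?y 1) \<le> c ?y - (\<Sum>k\<in>{1..N} - {1}. ?g k (?y k))"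
      by (rule c_transform_le[OF cg one_in y])
    then have "c_transform N D c ?g 1 x \<le> c ?y - ((\<Sum>k=2..N. f k (?y k)) + e * h (?y j))"
      unfolding other_indices sum_g by simp
    moreover have "c ?y - (f 1 (?y 1) + (\<Sum>k=2..N. f k (?y k))) = 0"
      using z unfolding c_normal_iff sum_split_first by blast
    ultimately have "e * h (z j) \<le> f 1 x - c_transform N D c ?g 1 x"
      using j1(2) by simp
    then show ?thesis
      using e by (simp add: q_def pos_le_divide_eq mult.commute)
  qed
  obtain y where y: "y \<in> points" "y 1 = x"
    "c_transform N D c ?g 1 x = c y - (\<Sum>k\<in>{1..N} - {1}. ?g k (y k))"
    by (rule c_transform_attained[OF cg one_in x]) blast
  have eq: "c_transform N D c ?g 1 x = c y - ((\<Sum>k=2..N. f k (y k)) + e * h (y j))"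
    using y(3) unfolding other_indices sum_g .
  have "(\<Sum>k=1..N. f k (y k)) \<le> c y"
    using f(1) y(1) unfolding admissible_def by blast
  then have "f 1 x + (\<Sum>k=2..N. f k (y k)) \<le> c y"
    unfolding sum_split_first y(2) .
  then have "f 1 x - c_transform N D c ?g 1 x \<le> e * h (y j)"
    using eq by linarith
  then have upper: "q \<le> h (y j)"
    using e by (simp add: q_def pos_divide_le_eq mult.commute)
  obtain z where z: "z \<in> c_normal N D c f x"
    using c_normal_nonempty[OF cf f(2) x] by blast
  then have "z j \<in> mspace (D j)"
    using j unfolding c_normal_iff by blast
  then have q_low: "- H \<le> q"
    using H[of "z j"] lower[OF z] by linarith
  have h_y: "\<bar>h (y j)\<bar> \<le> H"
    using H[OF point_in_mspace[OF y(1) j1(1)]] .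
  then show "\<bar>q\<bar> \<le> H"
    using q_low upper by linarith
  have "f 1 x - c_transform N D c ?g 1 x = e * q"
    using e by (simp add: q_def)
  then have "c y - (\<Sum>k=1..N. f k (y k)) = e * (h (y j) - q)"
    unfolding sum_split_first y(2) using eq by (simp add: algebra_simps)
  also have "\<dots> \<le> e * (2 * H)"
    using e h_y q_low by (intro mult_left_mono) auto
  finally show "\<exists>y\<in>points. y 1 = x \<and> q \<le> h (y j) \<and> c y - (\<Sum>k=1..N. f k (y k)) \<le> e * (2 * H)"
    using y(1,2) upper by blast
qed

text \<open>
  Where the \<open>c\<close>-normal mapping is single-valued, the perturbed minimizers can only accumulate at
  its value, so the difference quotients converge.
\<close>

lemma perturbed_quotient_tendsto:
  assumes f: "f \<in> admissible N D c" "c_conjugate N D c f" and j: "j \<in> {2..N}"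
    and h: "continuous_map (mtopology_of (D j)) euclideanreal h"
    and x: "x \<in> mspace (D 1)" and z: "c_normal N D c f x = {z}"
    and e: "\<And>n. e n > 0" "e \<longlonglongrightarrow> 0"
  shows "(\<lambda>n. (f 1 x - c_transform N D c (f(j := \<lambda>t. f j t + e n * h t)) 1 x) / e n) \<longlonglongrightarrow> h (z j)"
    (is "?q \<longlonglongrightarrow> _")
proof (rule LIMSEQ_I)
  fix d :: real assume d: "d > 0"
  have j1: "j \<in> {1..N}"
    using j by auto
  have cf: "continuous_tuple N D f"
    using f(1) by (simp add: admissible_def)
  obtain H where H: "H \<ge> 0" "\<And>t. t \<in> mspace (D j) \<Longrightarrow> \<bar>h t\<bar> \<le> H"
    using continuous_map_bounded[OF compact[OF j1] h] by auto
  let ?slack = "\<lambda>y. c y - (\<Sum>k=1..N. f k (y k))"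
  \<comment> \<open>Points over \<open>x\<close> at which \<open>h\<close> is too large: none is a contact point, so by compactness the
    slack is bounded away from zero on them.\<close>
  define A where "A = {y \<in> points. y 1 = x} \<inter> {y \<in> topspace points_top. - h (y j) \<le> - (h (z j) + d)}"
  have A_closed: "closedin points_top A"
    unfolding A_def
    by (intro closedin_Int closedin_slice[OF one_in x] closedin_real_sublevel continuous_map_minus
        continuous_map_coordinate[OF h j1])
  have "\<exists>m>0. \<forall>y\<in>A. m \<le> ?slack y"
  proof (cases "A = {}")
    case True
    then show ?thesis
      by (intro exI[of _ 1]) simp
  next
    case False
    obtain a where a: "a \<in> A" "\<And>b. b \<in> A \<Longrightarrow> ?slack a \<le> ?slack b"
      using continuous_map_attains_min[OF compact_points_top continuous_slack[OF cf, of "{1..N}"] A_closed False]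
      by blast
    have a': "a \<in> points" "a 1 = x" "h (z j) + d \<le> h (a j)"
      using a(1) by (auto simp: A_def)
    have "?slack a \<noteq> 0"
    proof
      assume "?slack a = 0"
      then have "restrict a {2..N} = z"
        using restrict_in_c_normal[OF a'(1), of f] z a'(2) by simp
      then have "a j = z j"
        using j by auto
      then show False
        using a'(3) d by simp
    qed
    moreover have "?slack a \<ge> 0"
      using f(1) a'(1) unfolding admissible_def by fastforce
    ultimately show ?thesis
      using a(2) by (intro exI[of _ "?slack a"]) auto
  qed
  then obtain m where m: "m > 0" "\<And>y. y \<in> A \<Longrightarrow> m \<le> ?slack y" by blast
  have "(\<lambda>n. e n * (2 * H)) \<longlonglongrightarrow> 0 * (2 * H)"
    by (intro tendsto_intros e(2))
  then have "\<forall>\<^sub>F n in sequentially. e n * (2 * H) < m"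
    using m(1) by (intro order_tendstoD(2)) auto
  then obtain n0 where n0: "\<And>n. n \<ge> n0 \<Longrightarrow> e n * (2 * H) < m"
    unfolding eventually_sequentially by blast
  have "norm (?q n - h (z j)) < d" if n: "n \<ge> n0" for n
  proof -
    obtain y where y: "y \<in> points" "y 1 = x" "?q n \<le> h (y j)" "?slack y \<le> e n * (2 * H)"
      using perturbed_c_transform(2)[OF f j h H(2) e(1) x] by blast
    have "y \<notin> A"
      using m(2)[of y] y(4) n0[OF n] by linarith
    then have "h (y j) < h (z j) + d"
      using y(1,2) by (auto simp: A_def)
    moreover have "h (z j) \<le> ?q n"
      using perturbed_c_transform(1)[OF f j h H(2) e(1) x] z by blast
    ultimately show ?thesis
      using y(3) by (simp add: abs_less_iff)
  qed
  then show "\<exists>n0. \<forall>n\<ge>n0. norm (?q n - h (z j)) < d" by blast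
qed

end

section \<open>Transport maps and duality\<close>

context Lipschitz_transport_measures
begin

text \<open>
  The single-valued counterpart of \<open>transport_maps\<close>. The selection takes its values in the
  product everywhere, also where the multivalued map is not a singleton, so that no exceptional
  set has to be carried along.
\<close>

definition transport_selection :: "('a \<Rightarrow> nat \<Rightarrow> 'a) \<Rightarrow> bool" where
  "transport_selection T \<longleftrightarrow>
     (\<forall>x\<in>mspace (D 1). T x \<in> (\<Pi>\<^sub>E j\<in>{2..N}. mspace (D j))) \<and>
     (\<forall>j\<in>{2..N}. (\<lambda>x. T x j) \<in> measurable (completion (\<mu> 1)) (\<mu> j) \<and>
       distr (completion (\<mu> 1)) (\<mu> j) (\<lambda>x. T x j) = \<mu> j)"

lemma transport_maps_iff_selection:
  assumes T: "\<And>x. x \<in> mspace (D 1) \<Longrightarrow> T x \<in> s x"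
    and s: "\<And>x. x \<in> mspace (D 1) \<Longrightarrow> s x \<subseteq> (\<Pi>\<^sub>E j\<in>{2..N}. mspace (D j))"
    and ae: "AE x in \<mu> 1. s x = {T x}"
  shows "s \<in> transport_maps N D \<mu> \<longleftrightarrow> transport_selection T"
proof -
  have mp: "measure_preserving_mv (\<mu> 1) (\<mu> j) (\<lambda>x. (\<lambda>z. z j) ` s x) \<longleftrightarrow>
      (\<lambda>x. T x j) \<in> measurable (completion (\<mu> 1)) (\<mu> j) \<and>
      distr (completion (\<mu> 1)) (\<mu> j) (\<lambda>x. T x j) = \<mu> j" if j: "j \<in> {2..N}" for j
  proof (rule measure_preserving_mv_iff_distr)
    show "AE x in \<mu> 1. (\<lambda>z. z j) ` s x = {T x j}"
      using ae by eventually_elim simp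
    fix x assume "x \<in> space (\<mu> 1)"
    then have "T x \<in> (\<Pi>\<^sub>E j\<in>{2..N}. mspace (D j))"
      using T[of x] s[of x] space_mu[OF one_in] by auto
    then show "T x j \<in> space (\<mu> j)"
      using j space_mu[of j] by (simp add: PiE_iff)
  qed
  have "AE x in \<mu> 1. is_singleton (s x)"
    using ae by eventually_elim simp
  moreover have "\<forall>x\<in>mspace (D 1). s x \<noteq> {} \<and> s x \<subseteq> (\<Pi>\<^sub>E j\<in>{2..N}. mspace (D j))"
    using T s by blast
  moreover have "\<forall>x\<in>mspace (D 1). T x \<in> (\<Pi>\<^sub>E j\<in>{2..N}. mspace (D j))"
    using T s by blast
  ultimately show ?thesis
    unfolding transport_maps_def transport_selection_def using mp by blast
qed

lemma obtain_selection:
  assumes "\<And>x. x \<in> mspace (D 1) \<Longrightarrow> s x \<noteq> {}" and ae: "AE x in \<mu> 1. is_singleton (s x)"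
  obtains T where "\<And>x. x \<in> mspace (D 1) \<Longrightarrow> T x \<in> s x" "AE x in \<mu> 1. s x = {T x}"
proof
  show T: "(SOME z. z \<in> s x) \<in> s x" if "x \<in> mspace (D 1)" for x
    using assms(1)[OF that] by (simp add: some_in_eq)
  show "AE x in \<mu> 1. s x = {SOME z. z \<in> s x}"
    using ae by eventually_elim (auto simp: is_singleton_def)
qed

lemma selection_point:
  assumes "transport_selection T" "x \<in> mspace (D 1)"
  shows "(T x)(1 := x) \<in> points"
  using assms insert_first_point by (auto simp: transport_selection_def)

text \<open>
  Adding \<open>x\<close> itself as first coordinate makes all \<open>N\<close> marginals alike: the push-forward of the
  completed measure along the point \<open>(T x)(1 := x)\<close> has the marginals \<open>\<mu> 1, \<dots>, \<mu> N\<close>.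
\<close>

lemma selection_coordinate:
  assumes T: "transport_selection T" and j: "j \<in> {1..N}"
  shows "(\<lambda>x. ((T x)(1 := x)) j) \<in> measurable (completion (\<mu> 1)) (\<mu> j)"
    and "distr (completion (\<mu> 1)) (\<mu> j) (\<lambda>x. ((T x)(1 := x)) j) = \<mu> j"
proof -
  have "(\<lambda>x. x) \<in> measurable (completion (\<mu> 1)) (\<mu> 1)"
    by (rule measurable_completion) simp
  then have "(\<lambda>x. ((T x)(1 := x)) j) \<in> measurable (completion (\<mu> 1)) (\<mu> j) \<and>
    distr (completion (\<mu> 1)) (\<mu> j) (\<lambda>x. ((T x)(1 := x)) j) = \<mu> j"
    using T j distr_completion_id by (cases "j = 1") (auto simp: transport_selection_def)
  then show "(\<lambda>x. ((T x)(1 := x)) j) \<in> measurable (completion (\<mu> 1)) (\<mu> j)"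
    "distr (completion (\<mu> 1)) (\<mu> j) (\<lambda>x. ((T x)(1 := x)) j) = \<mu> j"
    by blast+
qed

lemma finite_completion: "finite_measure (completion (\<mu> 1))"
proof
  interpret finite_measure "\<mu> 1" using finite_mu[OF one_in] .
  show "emeasure (completion (\<mu> 1)) (space (completion (\<mu> 1))) \<noteq> \<infinity>"
    using emeasure_finite[of "space (\<mu> 1)"] by (simp add: main_part_sets)
qed

text \<open>
  A Lipschitz function is the infimum of the cones with apex on its graph, and countably many of
  these cones suffice; this makes the cost measurable along measurable coordinates, and the Borel
  sets of the product need not be compared with the product of the Borel sets.
\<close>

lemma cost_measurable:
  assumes y: "\<And>x. x \<in> space L \<Longrightarrow> y x \<in> points"
    and meas: "\<And>j. j \<in> {1..N} \<Longrightarrow> (\<lambda>x. y x j) \<in> measurable L (\<mu> j)"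
  shows "(\<lambda>x. c (y x)) \<in> borel_measurable L"
proof -
  have "\<exists>Q. countable Q \<and> Q \<subseteq> mspace (D j) \<and> (\<forall>x\<in>mspace (D j). \<forall>e>0. \<exists>q\<in>Q. mdist (D j) x q < e)"
    if "j \<in> {1..N}" for j
    by (rule compact_metric_countable_dense[OF compact[OF that]]) blast
  then obtain Q where Q: "\<And>j. j \<in> {1..N} \<Longrightarrow> countable (Q j)" "\<And>j. j \<in> {1..N} \<Longrightarrow> Q j \<subseteq> mspace (D j)"
    "\<And>j x e. \<lbrakk>j \<in> {1..N}; x \<in> mspace (D j); e > 0\<rbrakk> \<Longrightarrow> \<exists>q\<in>Q j. mdist (D j) x q < e"
    by metis
  define QP where "QP = (\<Pi>\<^sub>E j\<in>{1..N}. Q j)"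
  have QP_points: "QP \<subseteq> points"
    unfolding QP_def by (rule PiE_mono) (rule Q(2))
  have QP_countable: "countable QP"
    unfolding QP_def by (rule countable_PiE) (use Q(1) in auto)
  have approx: "\<exists>q\<in>QP. (\<Sum>j=1..N. mdist (D j) (z j) (q j)) < e" if z: "z \<in> points" and e: "e > 0" for z e
  proof -
    have "\<forall>j\<in>{1..N}. \<exists>q\<in>Q j. mdist (D j) (z j) q < e / N"
      using Q(3) point_in_mspace[OF z] e N_ge_2 by simp
    then obtain q where q: "\<And>j. j \<in> {1..N} \<Longrightarrow> q j \<in> Q j \<and> mdist (D j) (z j) (q j) < e / N"
      by metis
    have "(\<Sum>j=1..N. mdist (D j) (z j) (restrict q {1..N} j)) < (\<Sum>j=1..N. e / N)"
      using q by (intro sum_strict_mono) auto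
    then show ?thesis
      using q N_ge_2 by (intro bexI[of _ "restrict q {1..N}"]) (auto simp: QP_def)
  qed
  define cone where "cone q z = c q + K * (\<Sum>j=1..N. mdist (D j) (z j) (q j))" for q z
  have c_le: "c z \<le> cone q z" if "z \<in> points" "q \<in> QP" for z q
    using c_Lipschitz[of z q] that QP_points unfolding cone_def by fastforce
  have c_inf: "c z = (INF q\<in>QP. cone q z)" if z: "z \<in> points" for z
  proof (rule sym, rule cInf_eq_non_empty)
    show "(\<lambda>q. cone q z) ` QP \<noteq> {}"
      using approx[OF z zero_less_one] by blast
    show "c z \<le> t" if "t \<in> (\<lambda>q. cone q z) ` QP" for t
      using that c_le[OF z] by blast
    show "t \<le> c z" if t: "\<And>r. r \<in> (\<lambda>q. cone q z) ` QP \<Longrightarrow> t \<le> r" for t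
    proof (rule field_le_epsilon)
      fix e :: real assume "e > 0"
      then obtain q where q: "q \<in> QP" "(\<Sum>j=1..N. mdist (D j) (z j) (q j)) < e / (2 * K)"
        using approx[OF z, of "e / (2 * K)"] K_pos by auto
      have "\<bar>c z - c q\<bar> \<le> K * (\<Sum>j=1..N. mdist (D j) (z j) (q j))"
        using c_Lipschitz[OF z] q(1) QP_points by blast
      moreover have "K * (\<Sum>j=1..N. mdist (D j) (z j) (q j)) < e / 2"
        using q(2) K_pos by (simp add: field_simps)
      ultimately have "cone q z \<le> c z + e"
        unfolding cone_def by linarith
      then show "t \<le> c z + e"
        using t q(1) by (meson imageI order_trans)
    qed
  qed
  have "(\<lambda>x. cone q (y x)) \<in> borel_measurable L" if q: "q \<in> QP" for q
  proof -
    have "(\<lambda>x. mdist (D j) (y x j) (q j)) \<in> borel_measurable L" if j: "j \<in> {1..N}" for j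
    proof -
      have "q j \<in> mspace (D j)"
        using point_in_mspace[OF subsetD[OF QP_points q] j] .
      then have "(\<lambda>t. mdist (D j) t (q j)) \<in> borel_measurable (\<mu> j)"
        by (intro borel_measurable_continuous_map[OF sets_mu[OF j]] continuous_map_mdist_right)
      from measurable_compose[OF meas[OF j] this] show ?thesis .
    qed
    then show ?thesis
      unfolding cone_def by (intro borel_measurable_add borel_measurable_times borel_measurable_sum) auto
  qed
  then have "(\<lambda>x. INF q\<in>QP. cone q (y x)) \<in> borel_measurable L"
    using QP_countable by (intro borel_measurable_cINF_real) auto
  then show ?thesis
    by (rule measurable_cong[THEN iffD2, rotated]) (simp add: c_inf y)
qed

lemma selection_cost_measurable:
  assumes T: "transport_selection T"
  shows "(\<lambda>x. c ((T x)(1 := x))) \<in> borel_measurable (completion (\<mu> 1))"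
  by (rule cost_measurable) (use selection_point[OF T] selection_coordinate(1)[OF T] space_mu[OF one_in] in auto)

lemma selection_cost_integrable:
  assumes T: "transport_selection T"
  shows "integrable (completion (\<mu> 1)) (\<lambda>x. c ((T x)(1 := x)))"
proof -
  interpret finite_measure "completion (\<mu> 1)" by (rule finite_completion)
  obtain B where "B \<ge> 0" "\<And>y. y \<in> points \<Longrightarrow> \<bar>c y\<bar> \<le> B"
    using continuous_map_bounded[OF compact_points_top continuous_cost] by auto
  then show ?thesis
    using selection_cost_measurable[OF T] selection_point[OF T] space_mu[OF one_in]
    by (intro integrable_const_bound[of _ B] AE_I2) auto
qed

lemma transport_cost_selection:
  assumes T: "transport_selection T" and ae: "AE x in \<mu> 1. s x = {T x}"
  shows "transport_cost \<mu> c s = (\<integral>x. c ((T x)(1 := x)) \<partial>completion (\<mu> 1))"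
proof -
  have eq: "AE x in \<mu> 1. c ((T x)(1 := x)) = c ((the_elem (s x))(1 := x))"
    using ae by eventually_elim simp
  have "(\<integral>x. c ((T x)(1 := x)) \<partial>completion (\<mu> 1)) = (\<integral>x. c ((the_elem (s x))(1 := x)) \<partial>completion (\<mu> 1))"
    using selection_cost_measurable[OF T]
      borel_measurable_completion_cong_AE[OF selection_cost_measurable[OF T] eq] AE_completion[OF eq]
    by (rule integral_cong_AE)
  then show ?thesis
    by (simp add: transport_cost_def)
qed

lemma dual_functional_selection:
  assumes T: "transport_selection T" and u: "continuous_tuple N D u"
  shows "integrable (completion (\<mu> 1)) (\<lambda>x. \<Sum>j=1..N. u j (((T x)(1 := x)) j))"
    and "dual_functional N \<mu> u = (\<integral>x. (\<Sum>j=1..N. u j (((T x)(1 := x)) j)) \<partial>completion (\<mu> 1))"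
proof -
  have u_meas: "u j \<in> borel_measurable (\<mu> j)" if "j \<in> {1..N}" for j
    using tuple_integrable[OF u that] by blast
  have int: "integrable (completion (\<mu> 1)) (\<lambda>x. u j (((T x)(1 := x)) j))" if j: "j \<in> {1..N}" for j
    using integrable_distr_eq[OF selection_coordinate(1)[OF T j] u_meas[OF j]]
      selection_coordinate(2)[OF T j] tuple_integrable[OF u j] by simp
  show "integrable (completion (\<mu> 1)) (\<lambda>x. \<Sum>j=1..N. u j (((T x)(1 := x)) j))"
    by (rule Bochner_Integration.integrable_sum) (rule int)
  have "(\<integral>x. u j x \<partial>\<mu> j) = (\<integral>x. u j (((T x)(1 := x)) j) \<partial>completion (\<mu> 1))" if j: "j \<in> {1..N}" for j
    using integral_distr[OF selection_coordinate(1)[OF T j] u_meas[OF j]]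
      selection_coordinate(2)[OF T j] by simp
  then show "dual_functional N \<mu> u = (\<integral>x. (\<Sum>j=1..N. u j (((T x)(1 := x)) j)) \<partial>completion (\<mu> 1))"
    unfolding dual_functional_def using int by (subst Bochner_Integration.integral_sum) auto
qed

text \<open>Weak duality: integrate the constraint along a transport map.\<close>

lemma dual_le_transport_cost:
  assumes u: "u \<in> admissible N D c" and s: "s \<in> transport_maps N D \<mu>"
  shows "dual_functional N \<mu> u \<le> transport_cost \<mu> c s"
proof -
  have s': "\<And>x. x \<in> mspace (D 1) \<Longrightarrow> s x \<noteq> {}"
    "\<And>x. x \<in> mspace (D 1) \<Longrightarrow> s x \<subseteq> (\<Pi>\<^sub>E j\<in>{2..N}. mspace (D j))"
    "AE x in \<mu> 1. is_singleton (s x)"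
    using s by (simp_all add: transport_maps_def)
  obtain T where T: "\<And>x. x \<in> mspace (D 1) \<Longrightarrow> T x \<in> s x" "AE x in \<mu> 1. s x = {T x}"
    by (rule obtain_selection[OF s'(1,3)]) blast+
  have sel: "transport_selection T"
    using transport_maps_iff_selection[of T s, OF T(1) s'(2) T(2)] s by blast
  have cu: "continuous_tuple N D u"
    using u by (simp add: admissible_def)
  have "dual_functional N \<mu> u \<le> (\<integral>x. c ((T x)(1 := x)) \<partial>completion (\<mu> 1))"
    unfolding dual_functional_selection(2)[OF sel cu]
  proof (rule integral_mono[OF dual_functional_selection(1)[OF sel cu] selection_cost_integrable[OF sel]])
    fix x assume "x \<in> space (completion (\<mu> 1))"
    then have "(T x)(1 := x) \<in> points"
      using selection_point[OF sel] space_mu[OF one_in] by simp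
    then show "(\<Sum>j=1..N. u j (((T x)(1 := x)) j)) \<le> c ((T x)(1 := x))"
      using u unfolding admissible_def by blast
  qed
  then show ?thesis
    using transport_cost_selection[OF sel T(2)] by simp
qed

text \<open>
  First variation of the dual functional at a maximizer: the \<open>j\<close>-th component is raised by \<open>e * h\<close>,
  the first one is replaced by its transform, and the difference quotients pass to the limit under
  the integral because they are bounded by the maximum of \<open>\<bar>h\<bar>\<close>.
\<close>

lemma maximizer_variation:
  assumes f: "f \<in> admissible N D c" "c_conjugate N D c f"
    and max: "\<And>u. u \<in> admissible N D c \<Longrightarrow> dual_functional N \<mu> u \<le> dual_functional N \<mu> f"
    and j: "j \<in> {2..N}" and h: "continuous_map (mtopology_of (D j)) euclideanreal h"
    and T: "AE x in \<mu> 1. c_normal N D c f x = {T x}"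
    and T_meas: "(\<lambda>x. T x j) \<in> measurable (completion (\<mu> 1)) (\<mu> j)"
  shows "(\<integral>t. h t \<partial>\<mu> j) \<le> (\<integral>x. h (T x j) \<partial>completion (\<mu> 1))"
proof -
  have j1: "j \<in> {1..N}" "j \<noteq> 1"
    using j by auto
  have cf: "continuous_tuple N D f"
    using f(1) by (simp add: admissible_def)
  obtain H where H: "H \<ge> 0" "\<And>t. t \<in> mspace (D j) \<Longrightarrow> \<bar>h t\<bar> \<le> H"
    using continuous_map_bounded[OF compact[OF j1(1)] h] by auto
  define e where "e n = inverse (real (Suc n))" for n
  have e: "e n > 0" "e \<longlonglongrightarrow> 0" for n
    using LIMSEQ_inverse_real_of_nat by (simp_all add: e_def[abs_def])
  define g where "g n = f(j := \<lambda>t. f j t + e n * h t)" for n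
  define q where "q n x = (f 1 x - c_transform N D c (g n) 1 x) / e n" for n x
  have cg: "continuous_tuple N D (g n)" for n
    unfolding g_def by (rule continuous_tuple_perturbed[OF cf j1(1) h])
  have h_int: "integrable (\<mu> j) h"
    by (rule continuous_integrable[OF j1(1) h])
  have tr_int: "integrable (\<mu> 1) (c_transform N D c (g n) 1)" for n
    by (rule continuous_integrable[OF one_in c_transform_continuous[OF cg one_in]])
  have f1_int: "integrable (\<mu> 1) (f 1)"
    by (rule tuple_integrable[OF cf one_in])
  have q_int: "integrable (\<mu> 1) (q n)" for n
    unfolding q_def[abs_def] using f1_int tr_int by auto
  have le: "(\<integral>t. h t \<partial>\<mu> j) \<le> (\<integral>x. q n x \<partial>completion (\<mu> 1))" for n
  proof -
    \<comment> \<open>The competitor differs from \<open>f\<close> in the first and in the \<open>j\<close>-th component only.\<close>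
    let ?F = "(g n)(1 := c_transform N D c (g n) 1)"
    let ?d = "(\<integral>x. c_transform N D c (g n) 1 x \<partial>\<mu> 1) - (\<integral>x. f 1 x \<partial>\<mu> 1)"
    have "?F \<in> admissible N D c"
      by (rule admissible_c_transform[OF cg one_in])
    then have "dual_functional N \<mu> ?F \<le> dual_functional N \<mu> f"
      by (rule max)
    moreover have "dual_functional N \<mu> ?F = dual_functional N \<mu> f + ?d + e n * (\<integral>t. h t \<partial>\<mu> j)"
    proof -
      have "(\<integral>x. ?F k x \<partial>\<mu> k) = (\<integral>x. f k x \<partial>\<mu> k) + (if k = 1 then ?d else 0)
          + (if k = j then e n * (\<integral>t. h t \<partial>\<mu> j) else 0)" for k
        using j1(2) h_int tuple_integrable[OF cf j1(1)] by (auto simp: g_def)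
      then show ?thesis
        using j1 one_in by (simp add: dual_functional_def sum.distrib)
    qed
    ultimately have "e n * (\<integral>t. h t \<partial>\<mu> j) \<le> - ?d"
      by simp
    also have "- ?d = e n * (\<integral>x. q n x \<partial>\<mu> 1)"
      using e(1)[of n] f1_int tr_int[of n] by (simp add: q_def)
    finally have "(\<integral>t. h t \<partial>\<mu> j) \<le> (\<integral>x. q n x \<partial>\<mu> 1)"
      using e(1)[of n] by simp
    then show ?thesis
      using q_int by (simp add: integral_completion)
  qed
  interpret finite_measure "completion (\<mu> 1)" by (rule finite_completion)
  have "(\<lambda>n. \<integral>x. q n x \<partial>completion (\<mu> 1)) \<longlonglongrightarrow> (\<integral>x. h (T x j) \<partial>completion (\<mu> 1))"
  proof (rule integral_dominated_convergence[where w="\<lambda>_. H"])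
    show "(\<lambda>x. h (T x j)) \<in> borel_measurable (completion (\<mu> 1))"
      using measurable_compose[OF T_meas] h_int by blast
    show "q n \<in> borel_measurable (completion (\<mu> 1))" for n
      using q_int[of n] by (intro measurable_completion) blast
    show "AE x in completion (\<mu> 1). (\<lambda>n. q n x) \<longlonglongrightarrow> h (T x j)"
      using AE_completion[OF T] AE_space
    proof eventually_elim
      case (elim x)
      then have "x \<in> mspace (D 1)"
        using space_mu[OF one_in] by simp
      from perturbed_quotient_tendsto[OF f j h this elim(1) e] show ?case
        by (simp add: q_def g_def)
    qed
    show "AE x in completion (\<mu> 1). norm (q n x) \<le> H" for n
    proof (rule AE_I2)
      fix x assume "x \<in> space (completion (\<mu> 1))"
      then have "x \<in> mspace (D 1)"
        using space_mu[OF one_in] by simp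
      from perturbed_c_transform(3)[OF f j h H(2) e(1) this] show "norm (q n x) \<le> H"
        by (simp add: q_def g_def)
    qed
  qed simp
  then show ?thesis
    by (rule LIMSEQ_le_const) (use le in blast)
qed

text \<open>
  The preimages of closed sets make the selection measurable. The first variation, applied to \<open>h\<close>
  and to \<open>- h\<close>, shows that it transports integrals of continuous functions correctly, hence the
  measures. The cost equals the dual value since the constraint is an equality along the
  \<open>c\<close>-normal mapping.
\<close>

lemma c_normal_optimal:
  assumes f: "f \<in> admissible N D c" "c_conjugate N D c f"
    and max: "\<And>u. u \<in> admissible N D c \<Longrightarrow> dual_functional N \<mu> u \<le> dual_functional N \<mu> f"
    and single: "AE x in \<mu> 1. is_singleton (c_normal N D c f x)"
  shows "c_normal N D c f \<in> transport_maps N D \<mu>"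
    and "transport_cost \<mu> c (c_normal N D c f) = dual_functional N \<mu> f"
proof -
  have cf: "continuous_tuple N D f"
    using f(1) by (simp add: admissible_def)
  obtain T where T: "\<And>x. x \<in> mspace (D 1) \<Longrightarrow> T x \<in> c_normal N D c f x"
    "AE x in \<mu> 1. c_normal N D c f x = {T x}"
    by (rule obtain_selection[OF c_normal_nonempty[OF cf f(2)] single]) blast+
  have T_PiE: "T x \<in> (\<Pi>\<^sub>E j\<in>{2..N}. mspace (D j))" if "x \<in> mspace (D 1)" for x
    using T(1)[OF that] unfolding c_normal_iff by blast
  have T_meas: "(\<lambda>x. T x j) \<in> measurable (completion (\<mu> 1)) (\<mu> j)" if j: "j \<in> {2..N}" for j
  proof -
    have j1: "j \<in> {1..N}"
      using j by auto
    show ?thesis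
    proof (rule measurable_sigma_sets)
      show "sets (\<mu> j) = sigma_sets (mspace (D j)) {E. closedin (mtopology_of (D j)) E}"
        using sets_mu[OF j1] by (simp add: sets_borel_of_closedin)
      show "{E. closedin (mtopology_of (D j)) E} \<subseteq> Pow (mspace (D j))"
        using closedin_subset[of "mtopology_of (D j)"] by auto
      show "(\<lambda>x. T x j) \<in> space (completion (\<mu> 1)) \<rightarrow> mspace (D j)"
        using PiE_mem[OF T_PiE j] space_mu[OF one_in] by simp
      fix E assume "E \<in> {E. closedin (mtopology_of (D j)) E}"
      then have E: "closedin (mtopology_of (D j)) E" by simp
      let ?A = "{x \<in> mspace (D 1). (\<lambda>z. z j) ` c_normal N D c f x \<inter> E \<noteq> {}}"
      have "?A \<in> sets (\<mu> 1)"
        using closedin_c_normal_preimage[OF f(1) j E] sets_mu[OF one_in]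
        by (auto simp: sets_borel_of_closedin)
      then have "?A \<in> sets (completion (\<mu> 1))"
        by (rule sets_completionI_sets)
      moreover have "AE x in \<mu> 1. T x j \<in> E \<longleftrightarrow> x \<in> ?A"
        using T(2) AE_space by eventually_elim (auto simp: space_mu[OF one_in])
      ultimately have "{x \<in> space (\<mu> 1). T x j \<in> E} \<in> sets (completion (\<mu> 1))"
        by (rule completion_set_AE_eq(1)[rotated])
      moreover have "(\<lambda>x. T x j) -` E \<inter> space (completion (\<mu> 1)) = {x \<in> space (\<mu> 1). T x j \<in> E}"
        by auto
      ultimately show "(\<lambda>x. T x j) -` E \<inter> space (completion (\<mu> 1)) \<in> sets (completion (\<mu> 1))"
        by simp
    qed
  qed
  have T_distr: "distr (completion (\<mu> 1)) (\<mu> j) (\<lambda>x. T x j) = \<mu> j" if j: "j \<in> {2..N}" for j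
  proof -
    have j1: "j \<in> {1..N}"
      using j by auto
    show ?thesis
    proof (rule measure_eqI_continuous)
      show "sets (distr (completion (\<mu> 1)) (\<mu> j) (\<lambda>x. T x j)) = sets (borel_of (mtopology_of (D j)))"
        "sets (\<mu> j) = sets (borel_of (mtopology_of (D j)))"
        using sets_mu[OF j1] by simp_all
      show "finite_measure (\<mu> j)"
        by (rule finite_mu[OF j1])
      show "finite_measure (distr (completion (\<mu> 1)) (\<mu> j) (\<lambda>x. T x j))"
        by (rule finite_measure.finite_measure_distr[OF finite_completion T_meas[OF j]])
      fix h :: "'a \<Rightarrow> real" assume h: "continuous_map (mtopology_of (D j)) euclideanreal h"
      then have h': "continuous_map (mtopology_of (D j)) euclideanreal (\<lambda>t. - h t)"
        by (rule continuous_map_minus)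
      have "h \<in> borel_measurable (\<mu> j)"
        by (rule borel_measurable_continuous_map[OF sets_mu[OF j1] h])
      then have "(\<integral>t. h t \<partial>distr (completion (\<mu> 1)) (\<mu> j) (\<lambda>x. T x j)) = (\<integral>x. h (T x j) \<partial>completion (\<mu> 1))"
        by (rule integral_distr[OF T_meas[OF j]])
      moreover have "(\<integral>t. h t \<partial>\<mu> j) \<le> (\<integral>x. h (T x j) \<partial>completion (\<mu> 1))"
        by (rule maximizer_variation[OF f max j h T(2) T_meas[OF j]])
      moreover have "(\<integral>t. - h t \<partial>\<mu> j) \<le> (\<integral>x. - h (T x j) \<partial>completion (\<mu> 1))"
        by (rule maximizer_variation[OF f max j h' T(2) T_meas[OF j]])
      ultimately show "(\<integral>t. h t \<partial>distr (completion (\<mu> 1)) (\<mu> j) (\<lambda>x. T x j)) = (\<integral>t. h t \<partial>\<mu> j)"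
        by simp
    qed
  qed
  have sel: "transport_selection T"
    unfolding transport_selection_def using T_PiE T_meas T_distr by blast
  have sub: "c_normal N D c f x \<subseteq> (\<Pi>\<^sub>E j\<in>{2..N}. mspace (D j))" for x
    unfolding c_normal_def by blast
  show "c_normal N D c f \<in> transport_maps N D \<mu>"
    using transport_maps_iff_selection[of T "c_normal N D c f", OF T(1) sub T(2)] sel by blast
  have "c ((T x)(1 := x)) = (\<Sum>j=1..N. f j (((T x)(1 := x)) j))" if "x \<in> mspace (D 1)" for x
    using T(1)[OF that] unfolding c_normal_iff by simp
  then have "(\<integral>x. c ((T x)(1 := x)) \<partial>completion (\<mu> 1)) =
      (\<integral>x. (\<Sum>j=1..N. f j (((T x)(1 := x)) j)) \<partial>completion (\<mu> 1))"
    using space_mu[OF one_in] by (intro Bochner_Integration.integral_cong) auto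
  then show "transport_cost \<mu> c (c_normal N D c f) = dual_functional N \<mu> f"
    using transport_cost_selection[OF sel T(2)] dual_functional_selection(2)[OF sel cf] by simp
qed

end

theorem theorem4p1:
  fixes N :: nat
    and D :: "nat \<Rightarrow> 'a metric"
    and \<mu> :: "nat \<Rightarrow> 'a measure"
    and c :: "(nat \<Rightarrow> 'a) \<Rightarrow> real"
  assumes "N \<ge> 2"
    and "\<And>j. j \<in> {1..N} \<Longrightarrow> mspace (D j) \<noteq> {}"
    and "\<And>j. j \<in> {1..N} \<Longrightarrow> compact_space (mtopology_of (D j))"
    and "\<And>j. j \<in> {1..N} \<Longrightarrow> sets (\<mu> j) = sets (borel_of (mtopology_of (D j)))"
    and "\<And>j. j \<in> {1..N} \<Longrightarrow> finite_measure (\<mu> j)"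
    and "\<And>j. j \<in> {2..N} \<Longrightarrow> emeasure (\<mu> 1) (mspace (D 1)) = emeasure (\<mu> j) (mspace (D j))"
    and "lipschitz_cost N D c"
    and "condition_SV N D \<mu> c"
  shows "(\<forall>f. f \<in> admissible N D c \<and> c_conjugate N D c f \<and>
              (\<forall>u \<in> admissible N D c. dual_functional N \<mu> u \<le> dual_functional N \<mu> f) \<longrightarrow>
            c_normal N D c f \<in> transport_maps N D \<mu> \<and>
            ereal (transport_cost \<mu> c (c_normal N D c f)) =
              (INF s \<in> transport_maps N D \<mu>. ereal (transport_cost \<mu> c s))) \<and>
         (INF s \<in> transport_maps N D \<mu>. ereal (transport_cost \<mu> c s)) =
           (SUP u \<in> admissible N D c. ereal (dual_functional N \<mu> u))"
proof -
  obtain K where K: "K > 0" "\<forall>x \<in> (\<Pi>\<^sub>E j\<in>{1..N}. mspace (D j)). \<forall>y \<in> (\<Pi>\<^sub>E j\<in>{1..N}. mspace (D j)).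
      \<bar>c x - c y\<bar> \<le> K * (\<Sum>j=1..N. mdist (D j) (x j) (y j))"
    using assms(7) unfolding lipschitz_cost_def by blast
  interpret Lipschitz_transport_measures N D c K \<mu>
  proof (intro Lipschitz_transport_measures.intro Lipschitz_transport.intro
      Lipschitz_transport_measures_axioms.intro)
    fix j assume j: "j \<in> {1..N}"
    show "measure (\<mu> j) (mspace (D j)) = measure (\<mu> 1) (mspace (D 1))"
    proof (cases "j = 1")
      case False
      then have "j \<in> {2..N}"
        using j by auto
      from assms(6)[OF this] show ?thesis
        by (simp only: measure_def)
    qed simp
  next
    show "N \<ge> 2" "K > 0"
      by fact+
    show "mspace (D j) \<noteq> {}" "compact_space (mtopology_of (D j))"
      "sets (\<mu> j) = sets (borel_of (mtopology_of (D j)))" "finite_measure (\<mu> j)" if "j \<in> {1..N}" for j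
      using assms(2-5)[OF that] by blast+
    show "\<bar>c x - c y\<bar> \<le> K * (\<Sum>j=1..N. mdist (D j) (x j) (y j))"
      if "x \<in> (\<Pi>\<^sub>E j\<in>{1..N}. mspace (D j))" "y \<in> (\<Pi>\<^sub>E j\<in>{1..N}. mspace (D j))" for x y
      using K(2) that by blast
  qed
  have optimal: "c_normal N D c f \<in> transport_maps N D \<mu>"
      "transport_cost \<mu> c (c_normal N D c f) = dual_functional N \<mu> f"
      "(INF s \<in> transport_maps N D \<mu>. ereal (transport_cost \<mu> c s)) = ereal (dual_functional N \<mu> f)"
    if f: "f \<in> admissible N D c" "c_conjugate N D c f"
      and max: "\<And>u. u \<in> admissible N D c \<Longrightarrow> dual_functional N \<mu> u \<le> dual_functional N \<mu> f" for f
  proof -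
    have "AE x in \<mu> 1. is_singleton (c_normal N D c f x)"
      using assms(8) f unfolding condition_SV_def admissible_def by blast
    note opt = c_normal_optimal[OF f max this]
    show "c_normal N D c f \<in> transport_maps N D \<mu>"
      "transport_cost \<mu> c (c_normal N D c f) = dual_functional N \<mu> f"
      using opt by blast+
    show "(INF s \<in> transport_maps N D \<mu>. ereal (transport_cost \<mu> c s)) = ereal (dual_functional N \<mu> f)"
    proof (rule antisym)
      show "(INF s \<in> transport_maps N D \<mu>. ereal (transport_cost \<mu> c s)) \<le> ereal (dual_functional N \<mu> f)"
        using INF_lower[OF opt(1), of "\<lambda>s. ereal (transport_cost \<mu> c s)"] opt(2) by simp
      show "ereal (dual_functional N \<mu> f) \<le> (INF s \<in> transport_maps N D \<mu>. ereal (transport_cost \<mu> c s))"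
        using dual_le_transport_cost[OF f(1)] by (intro INF_greatest) simp
    qed
  qed
  obtain f where f: "f \<in> admissible N D c" "c_conjugate N D c f"
    "\<And>u. u \<in> admissible N D c \<Longrightarrow> dual_functional N \<mu> u \<le> dual_functional N \<mu> f"
    by (rule dual_maximizer_exists) blast
  have "(SUP u \<in> admissible N D c. ereal (dual_functional N \<mu> u)) = ereal (dual_functional N \<mu> f)"
  proof (rule antisym)
    show "(SUP u \<in> admissible N D c. ereal (dual_functional N \<mu> u)) \<le> ereal (dual_functional N \<mu> f)"
      using f(3) by (intro SUP_least) simp
    show "ereal (dual_functional N \<mu> f) \<le> (SUP u \<in> admissible N D c. ereal (dual_functional N \<mu> u))"
      using f(1) by (rule SUP_upper)
  qed
  then have duality: "(INF s \<in> transport_maps N D \<mu>. ereal (transport_cost \<mu> c s)) =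
      (SUP u \<in> admissible N D c. ereal (dual_functional N \<mu> u))"
    using optimal(3)[OF f] by simp
  show ?thesis
  proof (intro conjI allI impI)
    fix g assume g: "g \<in> admissible N D c \<and> c_conjugate N D c g \<and>
      (\<forall>u \<in> admissible N D c. dual_functional N \<mu> u \<le> dual_functional N \<mu> g)"
    then have g': "g \<in> admissible N D c" "c_conjugate N D c g"
      "\<And>u. u \<in> admissible N D c \<Longrightarrow> dual_functional N \<mu> u \<le> dual_functional N \<mu> g"
      by blast+
    show "c_normal N D c g \<in> transport_maps N D \<mu>"
      by (rule optimal(1)[OF g'])
    show "ereal (transport_cost \<mu> c (c_normal N D c g)) =
        (INF s \<in> transport_maps N D \<mu>. ereal (transport_cost \<mu> c s))"
      using optimal(2)[OF g'] optimal(3)[OF g'] by simp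
  qed (rule duality)
qed

end
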